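(* Let $m\geq1$, $r=m-1$ and $\tau=s+2$. For $\operatorname{Re}s>0$ let $$ \mathcal{Z}_m(s)=\int_{\Omega_m}e^{-\ell_m(x)}f_m(x)^s\,dx . $$ Then the meromorphic continuation of $\mathcal{Z}_m(s)$ to $\mathbb{C}$ is $$ \mathcal{Z}_m(s)=2^{\,r-rm\tau}(2\pi)^r\,\Gamma(\tau-1)\prod_{j=2}^{m}\frac{\Gamma(j\tau-1)}{\Gamma((j-1)\tau)}. $$ For $m=1$ the formula is interpreted as $\mathcal{Z}_1(s)=\Gamma(s+1)$.
   Context: For $x=(x_0,\ldots,x_{2m-2})\in\mathbb{R}^{2m-1}$ put $H_m(x)=(x_{i+j})_{0\leq i,j\leq m-1}$ (the Hankel matrix) and $f_m(x)=\det H_m(x)$. Let $\Omega_m=\{x\in\mathbb{R}^{2m-1}:H_m(x)\text{ is positive definite}\}$, and let $\ell_m(x)=\sum_{j=0}^{m-1}\binom{m-1}{j}x_{2j}$. Here $dx=dx_0\cdots dx_{2m-2}$ is Lebesgue measure, $f_m(x)^s$ is defined using the real logarithm of $f_m(x)>0$ on $\Omega_m$, and the integral converges absolutely for $\operatorname{Re}s>0$. $\Gamma$ is the Gamma function. *)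

theory Defs
  imports
    "HOL-Complex_Analysis.Complex_Analysis"
    "Jordan_Normal_Form.Determinant"
begin

text \<open>
  A point \<open>(x\<^sub>0, \<dots>, x\<^sub>2\<^sub>m\<^sub>-\<^sub>2)\<close> of Euclidean \<open>(2m-1)\<close>-space is a function \<open>x :: nat \<Rightarrow> real\<close> in
  \<open>{..<2*m-1} \<rightarrow>\<^sub>E UNIV\<close>, so that the dimension can depend on the natural number \<open>m\<close>.
  Lebesgue measure is the product of \<open>2m-1\<close> copies of \<^term>\<open>lborel\<close>.
\<close>

definition coord_lebesgue :: "nat \<Rightarrow> (nat \<Rightarrow> real) measure" where
  "coord_lebesgue n = Pi\<^sub>M {..<n} (\<lambda>_. lborel)"

definition hankel_mat :: "nat \<Rightarrow> (nat \<Rightarrow> real) \<Rightarrow> real mat" where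
  "hankel_mat m x = Matrix.mat m m (\<lambda>(i, j). x (i + j))"

definition hankel_det :: "nat \<Rightarrow> (nat \<Rightarrow> real) \<Rightarrow> real" where
  "hankel_det m x = Determinant.det (hankel_mat m x)"

definition positive_definite_mat :: "real mat \<Rightarrow> bool" where
  "positive_definite_mat A \<longleftrightarrow>
     square_mat A \<and> transpose_mat A = A \<and>
     (\<forall>v \<in> carrier_vec (dim_row A). v \<noteq> 0\<^sub>v (dim_row A) \<longrightarrow> scalar_prod v (A *\<^sub>v v) > 0)"

definition hankel_cone :: "nat \<Rightarrow> (nat \<Rightarrow> real) set" where
  "hankel_cone m = {x \<in> {..<2 * m - 1} \<rightarrow>\<^sub>E UNIV. positive_definite_mat (hankel_mat m x)}"

definition hankel_form :: "nat \<Rightarrow> (nat \<Rightarrow> real) \<Rightarrow> real" where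
  "hankel_form m x = (\<Sum>j = 0..m - 1. real ((m - 1) choose j) * x (2 * j))"

text \<open>
  On \<^term>\<open>hankel_cone m\<close> the determinant is positive, so the complex \<open>powr\<close> below is
  \<open>exp (s * ln (hankel_det m x))\<close> with the real logarithm.
\<close>

definition hankel_integrand :: "nat \<Rightarrow> complex \<Rightarrow> (nat \<Rightarrow> real) \<Rightarrow> complex" where
  "hankel_integrand m s x =
     of_real (exp (- hankel_form m x)) * complex_of_real (hankel_det m x) powr s"

definition hankel_zeta :: "nat \<Rightarrow> complex \<Rightarrow> complex" where
  "hankel_zeta m s =
     set_lebesgue_integral (coord_lebesgue (2 * m - 1)) (hankel_cone m) (hankel_integrand m s)"

text \<open>
  As everywhere in the library, a function that is \<open>meromorphic_on\<close> a set may take arbitrary values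
  at isolated points, in particular at its poles and removable singularities; a meromorphic
  continuation is therefore determined only up to a set without limit points.
\<close>

definition is_meromorphic_continuation ::
    "(complex \<Rightarrow> complex) \<Rightarrow> complex set \<Rightarrow> (complex \<Rightarrow> complex) \<Rightarrow> bool" where
  "is_meromorphic_continuation f D F \<longleftrightarrow>
     F meromorphic_on UNIV \<and> (\<forall>s\<in>D. F s = f s)"

end

theory Submission
  imports Defs
begin

text \<open>
  The Hankel matrix of \<open>x\<close> is the Gram matrix of the monomials \<open>1, t, \<dots>, t\<^sup>m\<^sup>-\<^sup>1\<close> for the functional \<open>L\<close>
  on real polynomials with \<open>L(t\<^sup>k) = x\<^sub>k\<close>, and \<open>\<ell>\<^sub>m(x) = L((1 + t\<^sup>2)\<^sup>m\<^sup>-\<^sup>1)\<close>. The proof is a recursion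
  on \<open>m\<close> that replaces \<open>L\<close> by the functional \<open>p \<mapsto> L((1 + t\<^sup>2) p)\<close>, whose moments are the folded
  sequence \<open>y\<^sub>k = x\<^sub>k + x\<^sub>k\<^sub>+\<^sub>2\<close>. Clearly \<open>\<ell>\<^sub>m(x) = \<ell>\<^sub>m\<^sub>-\<^sub>1(y)\<close>, and \<open>(y, x\<^sub>0, x\<^sub>1)\<close> are coordinates in which
  Lebesgue measure is again Lebesgue measure, because each \<open>x\<^sub>k\<^sub>+\<^sub>2\<close> is \<open>y\<^sub>k\<close> translated by \<open>- x\<^sub>k\<close>.

  Let \<open>z\<close> be the fold of \<open>y\<close>. In the basis \<open>1, t, (1 + t\<^sup>2) t\<^sup>k\<close> the Gram matrix of \<open>L\<close> has the Hankel matrix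
  of \<open>z\<close> as its large diagonal block, so \<open>f\<^sub>m(x) = f\<^sub>m\<^sub>-\<^sub>2(z) det S\<close> with a symmetric \<open>2 \<times> 2\<close> Schur
  complement \<open>S\<close> whose entries are those of \<open>(x\<^sub>0, x\<^sub>1; x\<^sub>1, y\<^sub>0 - x\<^sub>0)\<close> minus functions of \<open>y\<close>. The trace of \<open>S\<close>
  is a function of \<open>y\<close> alone. The complex basis \<open>1, (1 + i t) t\<^sup>k\<close> of the polynomials of degree less than
  \<open>m - 1\<close> shows that it equals \<open>f\<^sub>m\<^sub>-\<^sub>1(y) / f\<^sub>m\<^sub>-\<^sub>2(z)\<close>, since \<open>|1 + i t|\<^sup>2 = 1 + t\<^sup>2\<close>. Hence
  \<open>f\<^sub>m(x) = f\<^sub>m\<^sub>-\<^sub>2(z) (\<rho>\<^sup>2 - |(x\<^sub>0, x\<^sub>1) - c(y)|\<^sup>2)\<close> with \<open>\<rho> = f\<^sub>m\<^sub>-\<^sub>1(y) / (2 f\<^sub>m\<^sub>-\<^sub>2(z))\<close>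
  (\<open>hankel_det_paraboloid\<close>). This is the Szego recursion for Toeplitz determinants, carried from the
  unit circle to the line by the Cayley transform.

  So \<open>\<Omega>\<^sub>m\<close> is fibred over \<open>\<Omega>\<^sub>m\<^sub>-\<^sub>1\<close> by discs of radius \<open>\<rho>\<close>, and on such a disc the integral of \<open>f\<^sub>m(x)\<^sup>a\<close> is
  \<open>\<pi> / ((a + 1) 2\<^sup>2\<^sup>a\<^sup>+\<^sup>2)\<close> times \<open>f\<^sub>m\<^sub>-\<^sub>1(y)\<^sup>2\<^sup>a\<^sup>+\<^sup>2 f\<^sub>m\<^sub>-\<^sub>2(z)\<^sup>-\<^sup>a\<^sup>-\<^sup>2\<close>. Therefore integrals of
  \<open>exp(- \<ell>\<^sub>m(x)) f\<^sub>m(x)\<^sup>a f\<^sub>m\<^sub>-\<^sub>1(y)\<^sup>b\<close> reduce to integrals of the same form with \<open>m - 1\<close> in place of \<open>m\<close> and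
  exponents \<open>2 a + 2 + b\<close> and \<open>- a - 2\<close> (\<open>has_bochner_integral_hankel_kernel_step\<close>). Starting from \<open>(s, 0)\<close>,
  the first exponent in the \<open>j\<close>-th integral is \<open>j \<tau> - 2\<close>, and after \<open>m - 1\<close> steps a one-dimensional
  Gamma integral is left:
  the value is \<open>\<Gamma>(m \<tau> - 1)\<close> times the product over \<open>1 \<le> j < m\<close> of \<open>\<pi> / ((j \<tau> - 1) 2\<^sup>2\<^sup>j\<^sup>\<tau>\<^sup>-\<^sup>2)\<close>. The stated
  product of Gamma quotients is the same number by \<open>(j \<tau> - 1) \<Gamma>(j \<tau> - 1) = \<Gamma>(j \<tau>)\<close>. The recursion for the
  absolute values has real exponents and gives absolute convergence; the continuation is unique by
  the identity theorem.
\<close>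

section \<open>Grafted bases and Schur complements\<close>

text \<open>
  The columns are the coefficients of \<open>1, \<dots>, t\<^sup>d\<^sup>-\<^sup>1\<close> followed by those of \<open>(1 + c t\<^sup>d) t\<^sup>k\<close> for \<open>k < n\<close>.
  Both the real basis (\<open>d = 2\<close>, \<open>c = 1\<close>) and the complex one (\<open>d = 1\<close>, \<open>c = \<i>\<close>) have this form.
\<close>

definition graft_mat :: "nat \<Rightarrow> nat \<Rightarrow> 'a::comm_ring_1 \<Rightarrow> 'a mat" where
  "graft_mat n d c = Matrix.mat (n + d) (n + d)
     (\<lambda>(i, j). if j < d then of_bool (i = j) else of_bool (i + d = j) + c * of_bool (i = j))"

lemma graft_mat_carrier [simp]: "graft_mat n d c \<in> carrier_mat (n + d) (n + d)"
  by (simp add: graft_mat_def)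

lemma mult_graft_mat:
  assumes "M \<in> carrier_mat k (n + d)" "i < k" "j < n + d"
  shows "(M * graft_mat n d c) $$ (i, j) =
           (if j < d then M $$ (i, j) else M $$ (i, j - d) + c * M $$ (i, j))"
proof -
  have "(M * graft_mat n d c) $$ (i, j) = (\<Sum>l<n + d. M $$ (i, l) * graft_mat n d c $$ (l, j))"
    using assms by (auto simp: scalar_prod_def graft_mat_def atLeast0LessThan intro!: sum.cong)
  also have "\<dots> = (\<Sum>l<n + d. if j < d then (if l = j then M $$ (i, l) else 0)
        else (if l = j - d then M $$ (i, l) else 0) + (if l = j then c * M $$ (i, l) else 0))"
    using assms by (intro sum.cong) (auto simp: graft_mat_def algebra_simps)
  also have "\<dots> = (if j < d then M $$ (i, j) else M $$ (i, j - d) + c * M $$ (i, j))"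
    using assms by (auto simp: sum.distrib)
  finally show ?thesis .
qed

lemma transpose_graft_mat_mult:
  assumes M: "M \<in> carrier_mat (n + d) k" and "i < n + d" "j < k"
  shows "(transpose_mat (graft_mat n d c) * M) $$ (i, j) =
           (if i < d then M $$ (i, j) else M $$ (i - d, j) + c * M $$ (i, j))"
proof -
  have "transpose_mat (graft_mat n d c) * M = transpose_mat (transpose_mat M * graft_mat n d c)"
    using M by (subst transpose_mult[where nr = k and n = "n + d" and nc = "n + d"]) auto
  moreover have "(transpose_mat M * graft_mat n d c) \<in> carrier_mat k (n + d)"
    using M by (intro mult_carrier_mat[where n = "n + d"]) auto
  ultimately have "(transpose_mat (graft_mat n d c) * M) $$ (i, j)
      = (transpose_mat M * graft_mat n d c) $$ (j, i)"
    using assms by (metis carrier_matD index_transpose_mat(1))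
  then show ?thesis
    using assms mult_graft_mat[of "transpose_mat M" k n d j i c] by auto
qed

lemma det_graft_mat:
  assumes "d > 0"
  shows "Determinant.det (graft_mat n d c) = c ^ n"
proof -
  have "upper_triangular (graft_mat n d c)"
    using assms by (auto simp: graft_mat_def upper_triangular_def)
  then have "Determinant.det (graft_mat n d c) = prod_list (diag_mat (graft_mat n d c))"
    by (rule det_upper_triangular) (rule graft_mat_carrier)
  also have "diag_mat (graft_mat n d c) = map (\<lambda>i. if i < d then 1 else c) [0..<n + d]"
    unfolding diag_mat_def by (rule map_cong) (use assms in \<open>auto simp: graft_mat_def\<close>)
  also have "prod_list \<dots> = (\<Prod>i<n + d. if i < d then 1 else c)"
    by (subst prod.distinct_set_conv_list[symmetric]) (auto simp: atLeast0LessThan)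
  also have "\<dots> = c ^ card ({..<n + d} - {..<d})"
    by (subst prod.If_cases) (auto simp: Diff_eq intro!: arg_cong[where f = "\<lambda>A. c ^ card A"])
  also have "{..<n + d} - {..<d} = {d..<n + d}"
    by auto
  finally show ?thesis by simp
qed

text \<open>
  The left factor carries its own constant \<open>c'\<close>, so that \<open>c' = - \<i>\<close> turns the congruence into the
  Hermitian one when \<open>c = \<i>\<close>.
\<close>

lemma graft_congruence:
  assumes "M \<in> carrier_mat (n + d) (n + d)"
  shows "transpose_mat (graft_mat n d c') * M * graft_mat n d c =
     four_block_mat
       (Matrix.mat d d (\<lambda>(i, j). M $$ (i, j)))
       (Matrix.mat d n (\<lambda>(i, j). M $$ (i, j) + c * M $$ (i, j + d)))
       (Matrix.mat n d (\<lambda>(i, j). M $$ (i, j) + c' * M $$ (i + d, j)))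
       (Matrix.mat n n (\<lambda>(i, j). M $$ (i, j) + c * M $$ (i, j + d)
          + c' * M $$ (i + d, j) + c' * c * M $$ (i + d, j + d)))"
proof (rule eq_matI, goal_cases)
  case (1 i j)
  then have ij: "i < n + d" "j < n + d" by auto
  have N: "transpose_mat (graft_mat n d c') * M \<in> carrier_mat (n + d) (n + d)"
    using assms by (intro mult_carrier_mat[where n = "n + d"]) auto
  have "(transpose_mat (graft_mat n d c') * M) $$ (k, l) =
      (if k < d then M $$ (k, l) else M $$ (k - d, l) + c' * M $$ (k, l))"
    if "k < n + d" "l < n + d" for k l
    using transpose_graft_mat_mult[OF assms that] .
  then show ?case
    using ij mult_graft_mat[OF N ij] by (auto simp: algebra_simps)
qed (use assms in \<open>auto simp: graft_mat_def\<close>)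

text \<open>
  Block elimination with \<open>W\<close> in the role of \<open>D\<inverse> C\<close>: multiplication by the unipotent matrix with
  lower left block \<open>- W\<close> clears the block \<open>C\<close>.
\<close>

lemma det_four_block_schur:
  fixes A :: "'a::idom mat"
  assumes "A \<in> carrier_mat d d" "B \<in> carrier_mat d n" "C \<in> carrier_mat n d" "D \<in> carrier_mat n n"
    and W: "W \<in> carrier_mat n d" "D * W = C"
  shows "Determinant.det (four_block_mat A B C D) = Determinant.det (A - B * W) * Determinant.det D"
proof -
  let ?V = "four_block_mat (1\<^sub>m d) (0\<^sub>m d n) (- W) (1\<^sub>m n)"
  have BW: "B * W \<in> carrier_mat d d" and [simp]: "B * - W = - (B * W)" "D * - W = - C"
    using assms by auto
  have "four_block_mat A B C D * ?V = four_block_mat (A - B * W) B (0\<^sub>m n d) D"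
    using assms BW
    by (subst mult_four_block_mat[where ?nr1.0 = d and ?n1.0 = d and ?n2.0 = n and ?nr2.0 = n and ?nc1.0 = d and ?nc2.0 = n])
       (auto simp: minus_add_uminus_mat[symmetric])
  moreover have "Determinant.det ?V = 1"
    using W by (subst det_four_block_mat_upper_right_zero[where n = d and m = n]) auto
  moreover have "Determinant.det (four_block_mat A B C D * ?V)
      = Determinant.det (four_block_mat A B C D) * Determinant.det ?V"
    by (intro det_mult[where n = "d + n"] four_block_carrier_mat one_carrier_mat assms(1,4))
  moreover have "Determinant.det (four_block_mat (A - B * W) B (0\<^sub>m n d) D)
      = Determinant.det (A - B * W) * Determinant.det D"
    by (intro det_four_block_mat_lower_left_zero[where n = d and m = n] minus_carrier_mat BW assms refl)
  ultimately show ?thesis by simp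
qed

text \<open>
  For symmetric blocks the same elimination from both sides is a congruence, so it also controls
  positive definiteness and not only the determinant.
\<close>

lemma four_block_schur_congruence:
  fixes A :: "'a::idom mat"
  assumes "A \<in> carrier_mat d d" "C \<in> carrier_mat n d" "D \<in> carrier_mat n n"
    and D: "transpose_mat D = D"
    and W: "W \<in> carrier_mat n d" "D * W = C"
  defines "V \<equiv> four_block_mat (1\<^sub>m d) (0\<^sub>m d n) (- W) (1\<^sub>m n)"
  shows "transpose_mat V * four_block_mat A (transpose_mat C) C D * V =
           four_block_mat (A - transpose_mat C * W) (0\<^sub>m d n) (0\<^sub>m n d) D"
proof -
  have WD: "transpose_mat W * D = transpose_mat C"
    using assms(3) W transpose_mult[of D n n W d] by (simp add: D)
  have V: "transpose_mat V = four_block_mat (1\<^sub>m d) (- transpose_mat W) (0\<^sub>m n d) (1\<^sub>m n)"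
    unfolding V_def using W
    by (subst transpose_four_block_mat[where ?nr1.0 = d and ?nc1.0 = d and ?nr2.0 = n and ?nc2.0 = n])
       (auto simp: transpose_uminus)
  have [simp]: "- transpose_mat W * D = - transpose_mat C" "- transpose_mat W * C = - (transpose_mat W * C)"
    using assms WD by auto
  have WC: "transpose_mat W * C = transpose_mat C * W"
    using assms(3) W WD by (metis assoc_mult_mat transpose_carrier_mat)
  have [simp]: "transpose_mat C * W \<in> carrier_mat d d" using assms by auto
  have Cc': "C + - C = 0\<^sub>m n d" using assms(2) by (metis add_uminus_minus_mat minus_r_inv_mat)
  have Cc: "transpose_mat C + - transpose_mat C = 0\<^sub>m d n" using assms(2) by (metis add_uminus_minus_mat minus_r_inv_mat transpose_carrier_mat)
  note mult = mult_four_block_mat[where ?nr1.0 = d and ?n1.0 = d and ?n2.0 = n and ?nr2.0 = n and ?nc1.0 = d and ?nc2.0 = n]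
  have AW: "A - transpose_mat C * W \<in> carrier_mat d d"
    by (rule minus_carrier_mat) fact
  have 1: "1\<^sub>m d * A + - transpose_mat W * C = A - transpose_mat C * W"
    using assms(1) WC by (metis \<open>- transpose_mat W * C = - (transpose_mat W * C)\<close>
        \<open>transpose_mat C * W \<in> carrier_mat d d\<close> add_uminus_minus_mat left_mult_one_mat)
  have 2: "1\<^sub>m d * transpose_mat C + - transpose_mat W * D = 0\<^sub>m d n"
    using assms(2) Cc by simp
  have 3: "0\<^sub>m n d * A + 1\<^sub>m n * C = C" "0\<^sub>m n d * transpose_mat C + 1\<^sub>m n * D = D"
    using assms(1-3) by simp_all
  have VM: "transpose_mat V * four_block_mat A (transpose_mat C) C D
      = four_block_mat (A - transpose_mat C * W) (0\<^sub>m d n) C D"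
    unfolding V by (subst mult) (use assms(1-3) W(1) in \<open>auto simp only: 1 2 3 transpose_carrier_mat uminus_carrier_mat one_carrier_mat zero_carrier_mat\<close>)
  have 4: "(A - transpose_mat C * W) * 1\<^sub>m d + 0\<^sub>m d n * - W = A - transpose_mat C * W"
    "(A - transpose_mat C * W) * 0\<^sub>m d n + 0\<^sub>m d n * 1\<^sub>m n = 0\<^sub>m d n"
    "C * 0\<^sub>m d n + D * 1\<^sub>m n = D"
    using assms(1-3) W(1) AW
    by (simp_all add: right_mult_one_mat[of _ d d] right_mult_one_mat[of _ n n]) (auto intro!: eq_matI)
  have 5: "C * 1\<^sub>m d + D * - W = 0\<^sub>m n d"
    using assms(2,3) W Cc' by simp
  have MV: "four_block_mat (A - transpose_mat C * W) (0\<^sub>m d n) C D * V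
      = four_block_mat (A - transpose_mat C * W) (0\<^sub>m d n) (0\<^sub>m n d) D"
    unfolding V_def by (subst mult) (use AW assms(2,3) W(1) in \<open>auto simp only: 4 5 uminus_carrier_mat one_carrier_mat zero_carrier_mat\<close>)
  show ?thesis unfolding VM MV ..
qed

lemma det_congruence:
  assumes "P \<in> carrier_mat n n" "M \<in> carrier_mat n n" "Q \<in> carrier_mat n n"
  shows "Determinant.det (transpose_mat P * M * Q) =
    Determinant.det P * Determinant.det M * Determinant.det Q"
  using assms
  by (simp add: det_mult[where n = n] det_transpose[where n = n] mult_carrier_mat[where n = n])

lemma det_mat_2:
  assumes "A \<in> carrier_mat 2 2"
  shows "Determinant.det A = A $$ (0, 0) * A $$ (1, 1) - A $$ (0, 1) * A $$ (1, 0)"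
proof -
  have "Determinant.det (mat_delete A i 0) = mat_delete A i 0 $$ (0, 0)" for i
    using assms by (intro det_single) auto
  moreover have "mat_delete A 0 0 $$ (0, 0) = A $$ (1, 1)" "mat_delete A (Suc 0) 0 $$ (0, 0) = A $$ (0, 1)"
    using assms by (auto simp: mat_delete_def)
  ultimately show ?thesis
    using laplace_expansion_column[OF assms, of 0]
    by (simp add: cofactor_def numeral_2_eq_2)
qed

section \<open>Folding a Hankel matrix\<close>

text \<open>The moments of \<open>p \<mapsto> L((1 + t\<^sup>2) p)\<close>, if \<open>x\<close> are the moments of \<open>L\<close>.\<close>

definition hankel_fold :: "(nat \<Rightarrow> real) \<Rightarrow> nat \<Rightarrow> real" where
  "hankel_fold x k = x k + x (k + 2)"

lemma hankel_mat_carrier [simp]: "hankel_mat m x \<in> carrier_mat m m"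
  by (simp add: hankel_mat_def)

lemma transpose_hankel_mat [simp]: "transpose_mat (hankel_mat m x) = hankel_mat m x"
  by (rule eq_matI) (auto simp: hankel_mat_def add.commute)

text \<open>
  The products of the basis \<open>1, t, (1 + t\<^sup>2) t\<^sup>k\<close> contain the factor \<open>1 + t\<^sup>2\<close> to the power \<open>0\<close>, \<open>1\<close> or \<open>2\<close>;
  accordingly the blocks consist of \<open>x\<close>, of its fold and of its double fold.
\<close>

lemma hankel_graft_congruence:
  "transpose_mat (graft_mat n 2 1) * hankel_mat (n + 2) x * graft_mat n 2 1 =
     four_block_mat (hankel_mat 2 x)
       (transpose_mat (Matrix.mat n 2 (\<lambda>(k, i). hankel_fold x (k + i))))
       (Matrix.mat n 2 (\<lambda>(k, i). hankel_fold x (k + i)))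
       (hankel_mat n (hankel_fold (hankel_fold x)))"
  by (subst graft_congruence, simp, rule cong_four_block_mat)
     (rule eq_matI; auto simp: hankel_mat_def hankel_fold_def add_ac)+

text \<open>
  Here the large block of the Hermitian Gram matrix contains
  \<open>(1 - \<i> t) (1 + \<i> t) = 1 + t\<^sup>2\<close>, so that a single fold already produces it.
\<close>

lemma complex_hankel_graft_congruence:
  "transpose_mat (graft_mat n 1 (- \<i>)) * map_mat of_real (hankel_mat (n + 1) y) * graft_mat n 1 \<i> =
     four_block_mat (Matrix.mat 1 1 (\<lambda>_. of_real (y 0)))
       (Matrix.mat 1 n (\<lambda>(i, k). of_real (y k) + \<i> * of_real (y (k + 1))))
       (Matrix.mat n 1 (\<lambda>(k, i). of_real (y k) - \<i> * of_real (y (k + 1))))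
       (map_mat of_real (hankel_mat n (hankel_fold y)))"
  by (subst graft_congruence, simp, rule cong_four_block_mat)
     (rule eq_matI; auto simp: hankel_mat_def hankel_fold_def add_ac)+

lemma hankel_solution:
  assumes "hankel_det n z \<noteq> 0"
  obtains w where "\<And>k i. k < n \<Longrightarrow> (\<Sum>l<n. z (k + l) * w l i) = y (k + i)"
proof -
  obtain H' where H': "H' \<in> carrier_mat n n" "hankel_mat n z * H' = 1\<^sub>m n"
    using det_non_zero_imp_unit[OF hankel_mat_carrier[of n z], of undefined] assms
    by (auto simp: hankel_det_def Units_def ring_mat_def)
  have eq: "(\<Sum>l<n. z (k + l) * H' $$ (l, j)) = of_bool (k = j)" if "k < n" "j < n" for k j
  proof -
    have "(hankel_mat n z * H') $$ (k, j) = of_bool (k = j)"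
      using that by (simp add: H'(2))
    then show ?thesis
      using that H'(1) by (auto simp: scalar_prod_def hankel_mat_def atLeast0LessThan)
  qed
  have "(\<Sum>l<n. z (k + l) * (\<Sum>j<n. H' $$ (l, j) * y (j + i))) = y (k + i)" if "k < n" for k i
  proof -
    have "(\<Sum>l<n. z (k + l) * (\<Sum>j<n. H' $$ (l, j) * y (j + i)))
        = (\<Sum>j<n. (\<Sum>l<n. z (k + l) * H' $$ (l, j)) * y (j + i))"
      unfolding sum_distrib_left sum_distrib_right
      by (subst sum.swap) (simp add: mult_ac)
    also have "\<dots> = (\<Sum>j<n. if j = k then y (j + i) else 0)"
      using that by (intro sum.cong) (auto simp: eq)
    finally show ?thesis using that by simp
  qed
  then show ?thesis by (rule that)
qed

text \<open>
  If the columns of \<open>w\<close> solve the linear systems with matrix \<open>(z\<^sub>k\<^sub>+\<^sub>l)\<close>, where \<open>z\<close> is the fold of \<open>y\<close>,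
  and right-hand sides \<open>(y\<^sub>k)\<close> and \<open>(y\<^sub>k\<^sub>+\<^sub>1)\<close>, then \<open>schur_corr\<close> is the matrix \<open>C\<^sup>T D\<inverse> C\<close> of a Schur
  complement, and \<open>schur_block\<close> is the complement itself: the Gram matrix of \<open>1\<close> and \<open>t\<close> after projection
  along the multiples of \<open>1 + t\<^sup>2\<close>.
\<close>

definition schur_corr :: "nat \<Rightarrow> (nat \<Rightarrow> real) \<Rightarrow> (nat \<Rightarrow> nat \<Rightarrow> real) \<Rightarrow> nat \<Rightarrow> nat \<Rightarrow> real" where
  "schur_corr n y w i j = (\<Sum>k<n. y (k + i) * w k j)"

definition schur_block :: "nat \<Rightarrow> (nat \<Rightarrow> real) \<Rightarrow> (nat \<Rightarrow> nat \<Rightarrow> real) \<Rightarrow> (nat \<Rightarrow> real) \<Rightarrow> real mat" where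
  "schur_block n y w x = Matrix.mat 2 2 (\<lambda>(i, j). x (i + j) - schur_corr n y w i j)"

context
  fixes n :: nat and y :: "nat \<Rightarrow> real" and w :: "nat \<Rightarrow> nat \<Rightarrow> real"
  assumes w: "\<And>k i. k < n \<Longrightarrow> (\<Sum>l<n. hankel_fold y (k + l) * w l i) = y (k + i)"
begin

text \<open>A symmetric matrix has a symmetric inverse, so \<open>C\<^sup>T D\<inverse> C\<close> is symmetric.\<close>

lemma schur_corr_commute: "schur_corr n y w i j = schur_corr n y w j i"
proof -
  have "schur_corr n y w i j = (\<Sum>k<n. (\<Sum>l<n. hankel_fold y (k + l) * w l i) * w k j)"
    by (simp add: schur_corr_def w)
  also have "\<dots> = (\<Sum>l<n. (\<Sum>k<n. hankel_fold y (l + k) * w k j) * w l i)"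
    unfolding sum_distrib_right by (subst sum.swap) (simp add: mult_ac add.commute)
  also have "\<dots> = schur_corr n y w j i"
    by (simp add: schur_corr_def w)
  finally show ?thesis .
qed

text \<open>
  The key identity: the trace of the real Schur complement for \<open>n + 2\<close> is a quotient of the two smaller
  determinants. It comes from the complex basis \<open>1, (1 + \<i> t) t\<^sup>k\<close>: projecting \<open>1\<close> away from the
  multiples of \<open>1 + \<i> t\<close> leaves a \<open>1 \<times> 1\<close> Schur complement \<open>y\<^sub>0 - v\<^sup>* D\<inverse> v\<close> with \<open>v\<close> the vector of the
  \<open>y\<^sub>k - \<i> y\<^sub>k\<^sub>+\<^sub>1\<close>. Its real and imaginary parts separate into the two diagonal corrections, and
  the cross terms cancel by symmetry.
\<close>

lemma hankel_det_eq_schur_trace: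
  "hankel_det (n + 1) y = (y 0 - schur_corr n y w 0 0 - schur_corr n y w 1 1) * hankel_det n (hankel_fold y)"
proof -
  let ?H = "map_mat complex_of_real (hankel_mat (n + 1) y)"
  let ?A = "Matrix.mat 1 1 (\<lambda>_. complex_of_real (y 0))"
  let ?B = "Matrix.mat 1 n (\<lambda>(i, k). complex_of_real (y k) + \<i> * of_real (y (k + 1)))"
  let ?C = "Matrix.mat n 1 (\<lambda>(k, i). complex_of_real (y k) - \<i> * of_real (y (k + 1)))"
  let ?D = "map_mat complex_of_real (hankel_mat n (hankel_fold y))"
  let ?W = "Matrix.mat n 1 (\<lambda>(l, i). complex_of_real (w l 0) - \<i> * of_real (w l 1))"
  have DW: "?D * ?W = ?C"
  proof (rule eq_matI, goal_cases)
    case (1 k i)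
    then have "k < n" by simp
    then have "(\<Sum>l<n. complex_of_real (hankel_fold y (k + l)) * of_real (w l i)) = of_real (y (k + i))" for i
      using w[of k i] by (simp flip: of_real_sum of_real_mult)
    note this[of 0] this[of 1]
    then show ?case
      using 1 by (simp add: scalar_prod_def hankel_mat_def atLeast0LessThan ring_distribs
          sum_subtractf mult.left_commute flip: sum_distrib_left)
  qed (auto simp: hankel_mat_def)
  have "(?B * ?W) $$ (0, 0)
      = (\<Sum>k<n. (of_real (y k) + \<i> * of_real (y (k + 1))) * (of_real (w k 0) - \<i> * of_real (w k 1)))"
    by (simp add: scalar_prod_def atLeast0LessThan)
  also have "\<dots> = of_real (schur_corr n y w 0 0) + of_real (schur_corr n y w 1 1)
       + \<i> * (of_real (schur_corr n y w 1 0) - of_real (schur_corr n y w 0 1))"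
    by (simp add: schur_corr_def algebra_simps sum.distrib sum_subtractf sum_distrib_left)
  finally have BW: "(?B * ?W) $$ (0, 0) = of_real (schur_corr n y w 0 0 + schur_corr n y w 1 1)"
    using schur_corr_commute[of 1 0] by simp
  have [simp]: "?A - ?B * ?W \<in> carrier_mat 1 1"
    by (intro minus_carrier_mat mult_carrier_mat[where n = n]) auto
  have "Determinant.det (?A - ?B * ?W) = of_real (y 0 - schur_corr n y w 0 0 - schur_corr n y w 1 1)"
    using BW by (subst det_single) auto
  moreover have "Determinant.det (four_block_mat ?A ?B ?C ?D)
      = Determinant.det (?A - ?B * ?W) * Determinant.det ?D"
    by (rule det_four_block_schur[where d = 1 and n = n, OF _ _ _ _ _ DW]) auto
  moreover have "Determinant.det (four_block_mat ?A ?B ?C ?D) = Determinant.det ?H"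
  proof -
    have "Determinant.det (transpose_mat (graft_mat n 1 (- \<i>)) * ?H * graft_mat n 1 \<i>)
        = (- \<i>) ^ n * Determinant.det ?H * \<i> ^ n"
      by (subst det_congruence[where n = "n + 1"]) (simp_all only: graft_mat_carrier map_carrier_mat
          hankel_mat_carrier det_graft_mat zero_less_one)
    also have "\<dots> = Determinant.det ?H * ((- \<i>) * \<i>) ^ n"
      by (simp only: power_mult_distrib mult_ac)
    finally show ?thesis
      unfolding complex_hankel_graft_congruence by simp
  qed
  \<comment> \<open>The basis change has determinant \<open>\<i>\<^sup>n\<close>, and its conjugate cancels it.\<close>
  ultimately have "complex_of_real (hankel_det (n + 1) y)
      = of_real ((y 0 - schur_corr n y w 0 0 - schur_corr n y w 1 1) * hankel_det n (hankel_fold y))"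
    by (simp add: hankel_det_def)
  then show ?thesis
    by (simp only: of_real_eq_iff)
qed

lemma hankel_block_congruence:
  assumes "hankel_fold x = y"
  obtains P where "P \<in> carrier_mat (n + 2) (n + 2)" "Determinant.det P = 1"
    "transpose_mat P * hankel_mat (n + 2) x * P =
       four_block_mat (schur_block n y w x) (0\<^sub>m 2 n) (0\<^sub>m n 2) (hankel_mat n (hankel_fold y))"
proof -
  let ?C = "Matrix.mat n 2 (\<lambda>(k, i). y (k + i))"
  let ?W = "Matrix.mat n 2 (\<lambda>(k, i). w k i)"
  let ?U = "graft_mat n 2 (1 :: real)"
  let ?V = "four_block_mat (1\<^sub>m 2) (0\<^sub>m 2 n) (- ?W) (1\<^sub>m n)"
  let ?H = "hankel_mat (n + 2) x"
  have DW: "hankel_mat n (hankel_fold y) * ?W = ?C"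
    by (rule eq_matI) (auto simp: scalar_prod_def hankel_mat_def atLeast0LessThan w)
  have S: "hankel_mat 2 x - transpose_mat ?C * ?W = schur_block n y w x"
    by (rule eq_matI)
       (auto simp: scalar_prod_def hankel_mat_def atLeast0LessThan schur_block_def schur_corr_def)
  have U: "?U \<in> carrier_mat (n + 2) (n + 2)" by (rule graft_mat_carrier)
  have V: "?V \<in> carrier_mat (n + 2) (n + 2)" 
    using four_block_carrier_mat[of "1\<^sub>m 2" 2 2 "1\<^sub>m n" n n] by (simp add: add.commute)
  have H: "?H \<in> carrier_mat (n + 2) (n + 2)" by simp
  have dV: "Determinant.det ?V = 1"
    by (subst det_four_block_mat_upper_right_zero[where n = 2 and m = n]) auto
  have "transpose_mat (?U * ?V) * ?H * (?U * ?V) = transpose_mat ?V * (transpose_mat ?U * ?H * ?U) * ?V"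
    using U V H by (simp add: transpose_mult[OF U V] assoc_mult_mat[where ?n\<^sub>1 = "n + 2" and ?n\<^sub>2 = "n + 2" and ?n\<^sub>3 = "n + 2" and ?n\<^sub>4 = "n + 2"] mult_carrier_mat[where n = "n + 2"])
  also have "\<dots> = four_block_mat (schur_block n y w x) (0\<^sub>m 2 n) (0\<^sub>m n 2) (hankel_mat n (hankel_fold y))"
    unfolding hankel_graft_congruence assms S[symmetric]
    by (rule four_block_schur_congruence[OF _ _ _ _ _ DW]) auto
  finally show ?thesis
    using U V dV by (intro that[of "?U * ?V"]) (auto simp: det_mult[OF U V] det_graft_mat intro: mult_carrier_mat)
qed

end

section \<open>Positive definiteness\<close>

lemma positive_definite_mat_congruence:
  assumes A: "A \<in> carrier_mat n n" "transpose_mat A = A" and P: "P \<in> carrier_mat n n" "Determinant.det P \<noteq> 0"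
  shows "positive_definite_mat (transpose_mat P * A * P) \<longleftrightarrow> positive_definite_mat A"
proof -
  obtain P' where P': "P' \<in> carrier_mat n n" "P * P' = 1\<^sub>m n" "P' * P = 1\<^sub>m n"
    using det_non_zero_imp_unit[OF P, of undefined] by (auto simp: Units_def ring_mat_def)
  have form: "scalar_prod u ((transpose_mat P * A * P) *\<^sub>v u) = scalar_prod (P *\<^sub>v u) (A *\<^sub>v (P *\<^sub>v u))"
    if u: "u \<in> carrier_vec n" for u
  proof -
    have "(transpose_mat P * A * P) *\<^sub>v u = transpose_mat P *\<^sub>v (A *\<^sub>v (P *\<^sub>v u))"
      using A P u by (simp add: assoc_mult_mat_vec[where n\<^sub>1 = n and n\<^sub>2 = n and n\<^sub>3 = n] mult_carrier_mat[where n = n])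
    moreover have "scalar_prod u (transpose_mat P *\<^sub>v (A *\<^sub>v (P *\<^sub>v u)))
        = scalar_prod (P *\<^sub>v u) (A *\<^sub>v (P *\<^sub>v u))"
      using A(1) P(1) u comm_scalar_prod[of u n] comm_scalar_prod[of "P *\<^sub>v u" n]
        transpose_vec_mult_scalar[OF P(1) u, of "A *\<^sub>v (P *\<^sub>v u)"]
      by (metis mult_mat_vec_carrier transpose_carrier_mat)
    ultimately show ?thesis by simp
  qed
  have sym: "transpose_mat (transpose_mat P * A * P) = transpose_mat P * A * P"
    using A P by (simp add: transpose_mult[where nr = n and n = n and nc = n] mult_carrier_mat[where n = n]
        assoc_mult_mat[where n\<^sub>1 = n and n\<^sub>2 = n and n\<^sub>3 = n and n\<^sub>4 = n])
  have inv: "P *\<^sub>v (P' *\<^sub>v v) = v" "P' *\<^sub>v (P *\<^sub>v v) = v" if "v \<in> carrier_vec n" for v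
    using that P P' by (simp_all flip: assoc_mult_mat_vec[where n\<^sub>1 = n and n\<^sub>2 = n and n\<^sub>3 = n])
  have dims: "dim_row (transpose_mat P * A * P) = n" "dim_row A = n"
      "square_mat (transpose_mat P * A * P)" "square_mat A"
    using A P by auto
  have zero: "Q *\<^sub>v 0\<^sub>v n = 0\<^sub>v n" if "Q \<in> carrier_mat n n" for Q :: "real mat"
    using that by (intro eq_vecI) auto
  have nz: "P *\<^sub>v u \<noteq> 0\<^sub>v n" if "u \<in> carrier_vec n" "u \<noteq> 0\<^sub>v n" for u
    using inv(2)[OF that(1)] that(2) zero P'(1) by metis
  have nz': "P' *\<^sub>v u \<noteq> 0\<^sub>v n" if "u \<in> carrier_vec n" "u \<noteq> 0\<^sub>v n" for u
    using inv(1)[OF that(1)] that(2) zero P(1) by metis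
  have carr: "P *\<^sub>v u \<in> carrier_vec n" "P' *\<^sub>v u \<in> carrier_vec n" if "u \<in> carrier_vec n" for u
    using that P P' by auto
  have "(\<forall>u\<in>carrier_vec n. u \<noteq> 0\<^sub>v n \<longrightarrow> scalar_prod (P *\<^sub>v u) (A *\<^sub>v (P *\<^sub>v u)) > 0) \<longleftrightarrow>
      (\<forall>v\<in>carrier_vec n. v \<noteq> 0\<^sub>v n \<longrightarrow> scalar_prod v (A *\<^sub>v v) > 0)" (is "?L \<longleftrightarrow> ?R")
  proof
    assume L: ?L
    show ?R
    proof (intro ballI impI)
      fix v :: "real vec" assume v: "v \<in> carrier_vec n" "v \<noteq> 0\<^sub>v n"
      from L[rule_format, OF carr(2)[OF v(1)] nz'[OF v]] show "scalar_prod v (A *\<^sub>v v) > 0"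
        by (simp only: inv(1)[OF v(1)])
    qed
  next
    assume ?R
    then show ?L using carr(1) nz by blast
  qed
  then show ?thesis
    unfolding positive_definite_mat_def dims sym A(2) using dims(3,4) form by simp
qed

lemma positive_definite_mat_block_diag:
  assumes S: "S \<in> carrier_mat d d" and D: "D \<in> carrier_mat n n" "transpose_mat D = D" "transpose_mat S = S"
  shows "positive_definite_mat (four_block_mat S (0\<^sub>m d n) (0\<^sub>m n d) D) \<longleftrightarrow>
    positive_definite_mat S \<and> positive_definite_mat D" (is "positive_definite_mat ?M \<longleftrightarrow> _")
proof -
  have form: "scalar_prod (u @\<^sub>v v) (?M *\<^sub>v (u @\<^sub>v v)) = scalar_prod u (S *\<^sub>v u) + scalar_prod v (D *\<^sub>v v)"
    if uv: "u \<in> carrier_vec d" "v \<in> carrier_vec n" for u v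
  proof -
    have [simp]: "S *\<^sub>v u \<in> carrier_vec d" "D *\<^sub>v v \<in> carrier_vec n" using S D uv by auto
    have "?M *\<^sub>v (u @\<^sub>v v) = (S *\<^sub>v u) @\<^sub>v (D *\<^sub>v v)"
      using uv S D by (subst four_block_mat_mult_vec[where ?nr1.0 = d and ?nc1.0 = d and ?nr2.0 = n and ?nc2.0 = n]) auto
    then show ?thesis using uv S D by (simp add: scalar_prod_append[where ?n1.0 = d and ?n2.0 = n])
  qed
  have sym: "transpose_mat ?M = ?M"
    using S D by (subst transpose_four_block_mat[where ?nr1.0 = d and ?nc1.0 = d and ?nr2.0 = n and ?nc2.0 = n]) auto
  have dims: "dim_row ?M = d + n" "dim_row S = d" "dim_row D = n"
    "square_mat ?M" "square_mat S" "square_mat D"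
    using S D by auto
  have z: "u @\<^sub>v v = 0\<^sub>v (d + n) \<longleftrightarrow> u = 0\<^sub>v d \<and> v = 0\<^sub>v n" if "u \<in> carrier_vec d" "v \<in> carrier_vec n" for u v :: "real vec"
  proof -
    have "0\<^sub>v (d + n) = 0\<^sub>v d @\<^sub>v (0\<^sub>v n :: real vec)" by (rule eq_vecI) auto
    then show ?thesis using that append_vec_eq[of u d "0\<^sub>v d" v "0\<^sub>v n"] by simp
  qed
  have 0: "scalar_prod (0\<^sub>v d) (S *\<^sub>v 0\<^sub>v d) = 0" "scalar_prod (0\<^sub>v n) (D *\<^sub>v 0\<^sub>v n) = 0"
    using S D by auto
  have pos: "positive_definite_mat ?M \<longleftrightarrow>
     (\<forall>u\<in>carrier_vec d. \<forall>v\<in>carrier_vec n. \<not> (u = 0\<^sub>v d \<and> v = 0\<^sub>v n) \<longrightarrow>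
       scalar_prod u (S *\<^sub>v u) + scalar_prod v (D *\<^sub>v v) > 0)"
    unfolding positive_definite_mat_def dims(1) all_vec_append using sym dims(4) form z by auto
  show ?thesis (is "?L \<longleftrightarrow> ?R")
  proof
    assume ?L
    then have "scalar_prod u (S *\<^sub>v u) + scalar_prod v (D *\<^sub>v v) > 0"
      if "u \<in> carrier_vec d" "v \<in> carrier_vec n" "\<not> (u = 0\<^sub>v d \<and> v = 0\<^sub>v n)" for u v
      using that pos by blast
    from this[of _ "0\<^sub>v n"] this[of "0\<^sub>v d"] show ?R
      using 0 dims D unfolding positive_definite_mat_def dims by auto
  next
    assume R: ?R
    then have "scalar_prod u (S *\<^sub>v u) > 0 \<or> u = 0\<^sub>v d" if "u \<in> carrier_vec d" for u
      using that dims unfolding positive_definite_mat_def by auto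
    moreover have "scalar_prod v (D *\<^sub>v v) > 0 \<or> v = 0\<^sub>v n" if "v \<in> carrier_vec n" for v
      using that dims R unfolding positive_definite_mat_def by auto
    ultimately show ?L
      unfolding pos using 0 by (metis add.right_neutral add_0 add_pos_pos)
  qed
qed

text \<open>
  The criterion uses the trace and not a single diagonal entry, because the trace of the Schur
  complement is the quantity that does not depend on \<open>x\<^sub>0\<close> and \<open>x\<^sub>1\<close>.
\<close>

lemma quadratic_form_2_pos_iff:
  fixes a b c :: real
  shows "(\<forall>u v. (u, v) \<noteq> (0, 0) \<longrightarrow> a * u\<^sup>2 + 2 * b * u * v + c * v\<^sup>2 > 0) \<longleftrightarrow> a + c > 0 \<and> a * c - b\<^sup>2 > 0"
    (is "?L \<longleftrightarrow> ?R")
proof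
  assume L: ?L
  have "a > 0" "c > 0" using L[rule_format, of 1 0] L[rule_format, of 0 1] by auto
  \<comment> \<open>The vector \<open>(b, - a)\<close> is orthogonal to the first row, so only the determinant survives.\<close>
  have "a * b\<^sup>2 + 2 * b * b * (- a) + c * (- a)\<^sup>2 > 0"
    using L[rule_format, of b "- a"] \<open>a > 0\<close> by auto
  also have "a * b\<^sup>2 + 2 * b * b * (- a) + c * (- a)\<^sup>2 = a * (a * c - b\<^sup>2)"
    by (simp add: power2_eq_square algebra_simps)
  finally show ?R using \<open>a > 0\<close> \<open>c > 0\<close> by (simp add: zero_less_mult_iff)
next
  assume R: ?R
  then have ac: "a * c > 0" by (smt (verit) zero_le_power2)
  then have a: "a > 0" "c > 0" using R by (auto simp: zero_less_mult_iff)
  show ?L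
  proof (intro allI impI)
    fix u v :: real assume uv: "(u, v) \<noteq> (0, 0)"
    have eq: "a * (a * u\<^sup>2 + 2 * b * u * v + c * v\<^sup>2) = (a * u + b * v)\<^sup>2 + (a * c - b\<^sup>2) * v\<^sup>2"
      by (simp add: power2_eq_square algebra_simps)
    have "(a * u + b * v)\<^sup>2 + (a * c - b\<^sup>2) * v\<^sup>2 > 0"
    proof (cases "v = 0")
      case True
      then show ?thesis using uv a by simp
    next
      case False
      then show ?thesis using R by (intro add_nonneg_pos mult_pos_pos) auto
    qed
    then show "a * u\<^sup>2 + 2 * b * u * v + c * v\<^sup>2 > 0"
      unfolding eq[symmetric] using a by (simp add: zero_less_mult_iff)
  qed
qed

lemma positive_definite_mat_2_iff:
  assumes S: "S \<in> carrier_mat 2 2" and sym: "S $$ (1, 0) = S $$ (0, 1)"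
  shows "positive_definite_mat S \<longleftrightarrow>
    S $$ (0, 0) + S $$ (1, 1) > 0 \<and> S $$ (0, 0) * S $$ (1, 1) - (S $$ (0, 1))\<^sup>2 > 0"
proof -
  have "transpose_mat S = S" 
    by (rule eq_matI) (use S sym in \<open>auto simp: less_2_cases_iff\<close>)
  moreover have "scalar_prod v (S *\<^sub>v v) = S $$ (0, 0) * (vec_index v 0)\<^sup>2
      + 2 * S $$ (0, 1) * vec_index v 0 * vec_index v 1 + S $$ (1, 1) * (vec_index v 1)\<^sup>2" if "v \<in> carrier_vec 2" for v
    using that S sym
    by (auto simp: scalar_prod_def mult_mat_vec_def numeral_2_eq_2 power2_eq_square algebra_simps)
  moreover have "v = 0\<^sub>v 2 \<longleftrightarrow> (vec_index v 0, vec_index v 1) = (0, 0)" if "v \<in> carrier_vec 2" for v :: "real vec"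
    using that by (auto intro!: eq_vecI simp: less_2_cases_iff)
  ultimately have "positive_definite_mat S \<longleftrightarrow> (\<forall>v\<in>carrier_vec 2. (vec_index v 0, vec_index v 1) \<noteq> (0, 0) \<longrightarrow>
      S $$ (0, 0) * (vec_index v 0)\<^sup>2 + 2 * S $$ (0, 1) * vec_index v 0 * vec_index v 1
        + S $$ (1, 1) * (vec_index v 1)\<^sup>2 > 0)"
    using S unfolding positive_definite_mat_def by auto
  also have "\<dots> \<longleftrightarrow> (\<forall>u v. (u, v) \<noteq> (0, 0) \<longrightarrow>
      S $$ (0, 0) * u\<^sup>2 + 2 * S $$ (0, 1) * u * v + S $$ (1, 1) * v\<^sup>2 > 0)"
  proof (intro iffI allI ballI, goal_cases)
    case (1 u v)
    from 1[THEN bspec, of "Matrix.vec 2 (\<lambda>i. if i = 0 then u else v)"] show ?case by simp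
  qed auto
  finally show ?thesis unfolding quadratic_form_2_pos_iff .
qed

lemma hankel_det_0 [simp]: "hankel_det 0 x = 1"
  by (simp add: hankel_det_def hankel_mat_def)

lemma hankel_det_1 [simp]: "hankel_det (Suc 0) x = x 0"
  by (subst hankel_det_def, subst det_single) (auto simp: hankel_mat_def)

lemma positive_definite_hankel_mat_iff:
  "positive_definite_mat (hankel_mat m x) \<longleftrightarrow>
     (\<forall>v. (\<exists>i<m. v i \<noteq> 0) \<longrightarrow> (\<Sum>i<m. \<Sum>j<m. v i * v j * x (i + j)) > 0)"
proof -
  have form: "scalar_prod v (hankel_mat m x *\<^sub>v v) =
      (\<Sum>i<m. \<Sum>j<m. vec_index v i * vec_index v j * x (i + j))" if "v \<in> carrier_vec m" for v
    using that by (auto simp: scalar_prod_def mult_mat_vec_def hankel_mat_def atLeast0LessThan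
        sum_distrib_left mult_ac intro!: sum.cong)
  have nz: "v \<noteq> 0\<^sub>v m \<longleftrightarrow> (\<exists>i<m. vec_index v i \<noteq> 0)" if "v \<in> carrier_vec m" for v :: "real vec"
    using that by (auto intro!: eq_vecI)
  have "positive_definite_mat (hankel_mat m x) \<longleftrightarrow> (\<forall>v\<in>carrier_vec m. (\<exists>i<m. vec_index v i \<noteq> 0) \<longrightarrow>
     (\<Sum>i<m. \<Sum>j<m. vec_index v i * vec_index v j * x (i + j)) > 0)"
    using carrier_matD[OF hankel_mat_carrier[of m x]] form nz
    unfolding positive_definite_mat_def by auto
  also have "\<dots> \<longleftrightarrow> (\<forall>v. (\<exists>i<m. v i \<noteq> 0) \<longrightarrow> (\<Sum>i<m. \<Sum>j<m. v i * v j * x (i + j)) > 0)"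
  proof (intro iffI allI ballI impI, goal_cases)
    case (1 v)
    from 1(1)[THEN bspec, of "Matrix.vec m v"] 1(2) show ?case by auto
  qed auto
  finally show ?thesis .
qed

text \<open>
  \<open>L((1 + t\<^sup>2) p\<^sup>2) = L(p\<^sup>2) + L((t p)\<^sup>2)\<close>: the coefficient vectors \<open>u\<close> and \<open>u'\<close> below are those of \<open>p\<close>
  and \<open>t p\<close>.
\<close>

lemma positive_definite_hankel_fold:
  assumes "positive_definite_mat (hankel_mat (Suc n) x)"
  shows "positive_definite_mat (hankel_mat n (hankel_fold x))"
  unfolding positive_definite_hankel_mat_iff
proof (intro allI impI)
  fix v :: "nat \<Rightarrow> real" assume v: "\<exists>i<n. v i \<noteq> 0"
  then obtain k where k: "k < n" "v k \<noteq> 0" by blast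
  define u where "u i = (if i < n then v i else 0)" for i
  define u' where "u' i = (if i = 0 then 0 else v (i - 1))" for i
  have *: "(\<Sum>i<Suc n. \<Sum>j<Suc n. f i * f j * x (i + j)) > 0" if "\<exists>i<Suc n. f i \<noteq> 0" for f
    using assms that unfolding positive_definite_hankel_mat_iff by blast
  have "0 < (\<Sum>i<Suc n. \<Sum>j<Suc n. u i * u j * x (i + j)) + (\<Sum>i<Suc n. \<Sum>j<Suc n. u' i * u' j * x (i + j))"
  proof (intro add_pos_pos *)
    show "\<exists>i<Suc n. u i \<noteq> 0" using k by (intro exI[of _ k]) (simp add: u_def)
    show "\<exists>i<Suc n. u' i \<noteq> 0" using k by (intro exI[of _ "Suc k"]) (simp add: u'_def)
  qed
  also have "(\<Sum>i<Suc n. \<Sum>j<Suc n. u i * u j * x (i + j)) = (\<Sum>i<n. \<Sum>j<n. v i * v j * x (i + j))"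
    by (simp add: u_def)
  also have "(\<Sum>i<Suc n. \<Sum>j<Suc n. u' i * u' j * x (i + j)) = (\<Sum>i<n. \<Sum>j<n. v i * v j * x (i + j + 2))"
    unfolding sum.lessThan_Suc_shift by (simp add: u'_def)
  finally show "(\<Sum>i<n. \<Sum>j<n. v i * v j * hankel_fold x (i + j)) > 0"
    by (simp add: hankel_fold_def algebra_simps sum.distrib)
qed

text \<open>
  For fixed \<open>y\<close> the determinant is, up to the factor \<open>f\<^sub>n(z)\<close>, the determinant of a symmetric \<open>2 \<times> 2\<close>
  matrix with prescribed trace \<open>T\<close>. Writing its diagonal as \<open>T / 2 \<plusminus> \<xi>\<close> and its off-diagonal entry as \<open>\<eta>\<close>
  gives \<open>T\<^sup>2 / 4 - \<xi>\<^sup>2 - \<eta>\<^sup>2\<close>, where \<open>\<xi>\<close> and \<open>\<eta>\<close> are translates of \<open>x\<^sub>0\<close> and \<open>x\<^sub>1\<close>. The centre \<open>c\<close> is the same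
  for all \<open>x\<close> over \<open>y\<close>, which is what makes the fibres discs. The criterion for positive definiteness asks
  for positive trace and determinant of this matrix and positive definiteness of the remaining block.
\<close>

lemma hankel_det_paraboloid:
  assumes nz: "hankel_det n (hankel_fold y) \<noteq> 0"
  obtains c :: "real \<times> real"
  where "\<And>x. hankel_fold x = y \<Longrightarrow> hankel_det (n + 2) x = hankel_det n (hankel_fold y) *
            ((hankel_det (n + 1) y / (2 * hankel_det n (hankel_fold y)))\<^sup>2
              - ((x 0 - fst c)\<^sup>2 + (x 1 - snd c)\<^sup>2))"
    and "\<And>x. hankel_fold x = y \<Longrightarrow> positive_definite_mat (hankel_mat (n + 2) x) \<longleftrightarrow>
           hankel_det (n + 1) y / hankel_det n (hankel_fold y) > 0 \<and>
           hankel_det (n + 2) x / hankel_det n (hankel_fold y) > 0 \<and>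
           positive_definite_mat (hankel_mat n (hankel_fold y))"
proof -
  obtain w where w: "\<And>k i. k < n \<Longrightarrow> (\<Sum>l<n. hankel_fold y (k + l) * w l i) = y (k + i)"
    using hankel_solution[OF nz, of y] by blast
  let ?K = "schur_corr n y w"
  let ?z = "hankel_det n (hankel_fold y)"
  define c where "c = ((y 0 + ?K 0 0 - ?K 1 1) / 2, ?K 0 1)"
  have K: "?K 1 0 = ?K 0 1" by (rule schur_corr_commute[OF w])
  have tr: "hankel_det (n + 1) y = (y 0 - ?K 0 0 - ?K 1 1) * ?z"
    by (rule hankel_det_eq_schur_trace[OF w])
  have step: "hankel_det (n + 2) x = ?z * ((x 0 - ?K 0 0) * (x 2 - ?K 1 1) - (x 1 - ?K 0 1)\<^sup>2)"
       "positive_definite_mat (hankel_mat (n + 2) x) \<longleftrightarrow>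
         y 0 - ?K 0 0 - ?K 1 1 > 0 \<and> (x 0 - ?K 0 0) * (x 2 - ?K 1 1) - (x 1 - ?K 0 1)\<^sup>2 > 0 \<and>
           positive_definite_mat (hankel_mat n (hankel_fold y))"
    if x: "hankel_fold x = y" for x
  proof -
    let ?S = "schur_block n y w x"
    obtain P where P: "P \<in> carrier_mat (n + 2) (n + 2)" "Determinant.det P = 1"
      "transpose_mat P * hankel_mat (n + 2) x * P =
       four_block_mat ?S (0\<^sub>m 2 n) (0\<^sub>m n 2) (hankel_mat n (hankel_fold y))"
      using hankel_block_congruence[OF w x] by blast
    have S: "?S \<in> carrier_mat 2 2" "?S $$ (0, 0) = x 0 - ?K 0 0" "?S $$ (0, 1) = x 1 - ?K 0 1"
      "?S $$ (1, 0) = x 1 - ?K 0 1" "?S $$ (1, 1) = x 2 - ?K 1 1"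
      using K by (auto simp: schur_block_def numeral_2_eq_2)
    have St: "transpose_mat ?S = ?S" 
      by (rule eq_matI) (use S in \<open>auto simp: less_2_cases_iff\<close>)
    have "hankel_det (n + 2) x = Determinant.det (transpose_mat P * hankel_mat (n + 2) x * P)"
      using P(2) by (subst det_congruence[OF P(1) hankel_mat_carrier P(1)]) (simp add: hankel_det_def)
    also have "\<dots> = Determinant.det ?S * ?z"
      unfolding P(3) hankel_det_def using S by (intro det_four_block_mat_lower_left_zero) auto
    also have "Determinant.det ?S = (x 0 - ?K 0 0) * (x 2 - ?K 1 1) - (x 1 - ?K 0 1)\<^sup>2"
      using det_mat_2[OF S(1)] S by (simp add: power2_eq_square)
    finally show "hankel_det (n + 2) x = ?z * ((x 0 - ?K 0 0) * (x 2 - ?K 1 1) - (x 1 - ?K 0 1)\<^sup>2)"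
      by simp
    have "positive_definite_mat (hankel_mat (n + 2) x) \<longleftrightarrow>
        positive_definite_mat (transpose_mat P * hankel_mat (n + 2) x * P)"
      by (rule positive_definite_mat_congruence[where n = "n + 2", symmetric]) (use P in auto)
    also have "\<dots> \<longleftrightarrow> positive_definite_mat ?S \<and> positive_definite_mat (hankel_mat n (hankel_fold y))"
      unfolding P(3) using S St by (intro positive_definite_mat_block_diag) auto
    also have "positive_definite_mat ?S \<longleftrightarrow>
        y 0 - ?K 0 0 - ?K 1 1 > 0 \<and> (x 0 - ?K 0 0) * (x 2 - ?K 1 1) - (x 1 - ?K 0 1)\<^sup>2 > 0"
    proof -
      have "y 0 = x 0 + x 2" using x by (auto simp: hankel_fold_def numeral_2_eq_2)
      then have "y 0 - ?K 0 0 - ?K 1 1 = (x 0 - ?K 0 0) + (x 2 - ?K 1 1)" by simp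
      then show ?thesis
        using S(3,4) by (simp only: positive_definite_mat_2_iff[OF S(1)] S)
    qed
    finally show "positive_definite_mat (hankel_mat (n + 2) x) \<longleftrightarrow>
         y 0 - ?K 0 0 - ?K 1 1 > 0 \<and> (x 0 - ?K 0 0) * (x 2 - ?K 1 1) - (x 1 - ?K 0 1)\<^sup>2 > 0 \<and>
           positive_definite_mat (hankel_mat n (hankel_fold y))" by simp
  qed
  show thesis
  proof (rule that[of c])
    fix x assume x: "hankel_fold x = y"
    then have y0: "y 0 = x 0 + x 2" by (auto simp: hankel_fold_def numeral_2_eq_2)
    have T: "hankel_det (n + 1) y / (2 * ?z) = (y 0 - ?K 0 0 - ?K 1 1) / 2"
      unfolding tr using nz by simp
    show "hankel_det (n + 2) x = ?z * ((hankel_det (n + 1) y / (2 * ?z))\<^sup>2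
              - ((x 0 - fst c)\<^sup>2 + (x 1 - snd c)\<^sup>2))"
      unfolding T step(1)[OF x] by (simp add: y0 c_def power2_eq_square field_simps)
    show "positive_definite_mat (hankel_mat (n + 2) x) \<longleftrightarrow>
           hankel_det (n + 1) y / ?z > 0 \<and> hankel_det (n + 2) x / ?z > 0 \<and>
           positive_definite_mat (hankel_mat n (hankel_fold y))"
      unfolding step(2)[OF x] unfolding step(1)[OF x] tr using nz by simp
  qed
qed

text \<open>
  A description of the cone by finitely many determinant inequalities, arranged so that the
  coordinates \<open>(y, x\<^sub>0, x\<^sub>1)\<close> see one inequality in \<open>(x\<^sub>0, x\<^sub>1)\<close> over the smaller cone. It also makes
  measurability evident.
\<close>

fun hankel_pos :: "nat \<Rightarrow> (nat \<Rightarrow> real) \<Rightarrow> bool" where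
  "hankel_pos 0 x \<longleftrightarrow> True"
| "hankel_pos (Suc n) x \<longleftrightarrow> hankel_det (Suc n) x > 0 \<and> hankel_pos n (hankel_fold x)"

lemma hankel_pos_det: "hankel_pos n x \<Longrightarrow> hankel_det n x > 0"
  by (cases n) auto

text \<open>
  The induction proceeds in steps of two, since the Schur complement relates \<open>n + 2\<close> to the double fold.
  Positivity of \<open>f\<^sub>n\<^sub>+\<^sub>1(y)\<close> fixes the sign of the trace, and then that of \<open>f\<^sub>n\<^sub>+\<^sub>2(x)\<close> decides.
\<close>

lemma positive_definite_hankel_iff_pos: "positive_definite_mat (hankel_mat n x) \<longleftrightarrow> hankel_pos n x"
proof (induction n arbitrary: x rule: induct_nat_012)
  case 0
  then show ?case by (simp add: positive_definite_hankel_mat_iff)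
next
  case 1
  show ?case
  proof
    assume "positive_definite_mat (hankel_mat (Suc 0) x)"
    then show "hankel_pos (Suc 0) x"
      unfolding positive_definite_hankel_mat_iff by (auto dest: spec[of _ "\<lambda>_. 1"])
  next
    assume "hankel_pos (Suc 0) x"
    then show "positive_definite_mat (hankel_mat (Suc 0) x)"
      unfolding positive_definite_hankel_mat_iff
      by (auto simp: zero_less_mult_iff linorder_neq_iff)
  qed
next
  case (ge2 n)
  let ?y = "hankel_fold x"
  show ?case
  proof
    assume pd: "positive_definite_mat (hankel_mat (Suc (Suc n)) x)"
    then have y: "hankel_pos (Suc n) ?y"
      using positive_definite_hankel_fold ge2 by blast
    then have z: "hankel_det n (hankel_fold ?y) > 0"
      using hankel_pos_det by auto
    then have nz: "hankel_det n (hankel_fold ?y) \<noteq> 0" by simp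
    obtain c :: "real \<times> real" where "positive_definite_mat (hankel_mat (n + 2) x) \<longleftrightarrow>
           hankel_det (n + 1) ?y / hankel_det n (hankel_fold ?y) > 0 \<and>
           hankel_det (n + 2) x / hankel_det n (hankel_fold ?y) > 0 \<and>
           positive_definite_mat (hankel_mat n (hankel_fold ?y))"
      using hankel_det_paraboloid[OF nz] by metis
    with pd z have "hankel_det (Suc (Suc n)) x > 0" by (simp add: zero_less_divide_iff)
    with y show "hankel_pos (Suc (Suc n)) x" by simp
  next
    assume pos: "hankel_pos (Suc (Suc n)) x"
    then have z: "hankel_det n (hankel_fold ?y) > 0"
      using hankel_pos_det by auto
    then have nz: "hankel_det n (hankel_fold ?y) \<noteq> 0" by simp
    obtain c :: "real \<times> real" where "positive_definite_mat (hankel_mat (n + 2) x) \<longleftrightarrow>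
           hankel_det (n + 1) ?y / hankel_det n (hankel_fold ?y) > 0 \<and>
           hankel_det (n + 2) x / hankel_det n (hankel_fold ?y) > 0 \<and>
           positive_definite_mat (hankel_mat n (hankel_fold ?y))"
      using hankel_det_paraboloid[OF nz] by metis
    with z pos ge2(1)[of "hankel_fold ?y"] show "positive_definite_mat (hankel_mat (Suc (Suc n)) x)"
      by simp
  qed
qed

section \<open>Lebesgue measure in folded coordinates\<close>

text \<open>The sequence that starts with the pair \<open>p\<close> and has the fold \<open>y\<close>.\<close>

fun hankel_lift :: "real \<times> real \<Rightarrow> (nat \<Rightarrow> real) \<Rightarrow> nat \<Rightarrow> real" where
  "hankel_lift p y 0 = fst p"
| "hankel_lift p y (Suc 0) = snd p"
| "hankel_lift p y (Suc (Suc k)) = y k - hankel_lift p y k"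

lemma hankel_fold_lift [simp]: "hankel_fold (hankel_lift p y) = y"
  by (rule ext) (simp add: hankel_fold_def)

lemma hankel_lift_cong:
  "(\<And>j. j + 2 \<le> k \<Longrightarrow> y j = y' j) \<Longrightarrow> hankel_lift p y k = hankel_lift p y' k"
  by (induction p y k rule: hankel_lift.induct) auto

lemma measurable_hankel_lift_component [measurable (raw)]:
  assumes "k < n + 2" "f \<in> borel_measurable M" "g \<in> measurable M (Pi\<^sub>M {..<n} (\<lambda>_. lborel))"
  shows "(\<lambda>\<omega>. hankel_lift (f \<omega>) (g \<omega>) k) \<in> borel_measurable M"
  using assms(1)
proof (induction k rule: induct_nat_012)
  case (ge2 k)
  have "(\<lambda>x. x k) \<in> borel_measurable (Pi\<^sub>M {..<n} (\<lambda>_. lborel :: real measure))"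
    using measurable_component_singleton[of k "{..<n}" "\<lambda>_. lborel :: real measure"] ge2 by simp
  from measurable_compose[OF assms(3) this] show ?case
    using ge2 by simp
qed (use assms(2) in \<open>auto simp flip: borel_prod intro: measurable_compose[OF _ measurable_fst] measurable_compose[OF _ measurable_snd]\<close>)

lemma measurable_hankel_lift [measurable (raw)]:
  assumes "f \<in> borel_measurable M" "g \<in> measurable M (Pi\<^sub>M {..<n} (\<lambda>_. lborel))"
  shows "(\<lambda>\<omega>. restrict (hankel_lift (f \<omega>) (g \<omega>)) {..<n + 2}) \<in> measurable M (Pi\<^sub>M {..<n + 2} (\<lambda>_. lborel))"
  by (rule measurable_restrict) (use measurable_hankel_lift_component[OF _ assms] in auto)

lemma product_sigma_finite_lborel: "product_sigma_finite (\<lambda>_. lborel)"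
  by standard

text \<open>
  Induction on the dimension: the last coordinate of the lifted point is \<open>y\<^sub>n\<close> minus a function of the earlier
  coordinates, so translation invariance replaces it by \<open>y\<^sub>n\<close>.
\<close>

lemma nn_integral_hankel_lift:
  fixes f :: "(nat \<Rightarrow> real) \<Rightarrow> ennreal"
  assumes "f \<in> borel_measurable (Pi\<^sub>M {..<n + 2} (\<lambda>_. lborel))"
  shows "(\<integral>\<^sup>+x. f x \<partial>Pi\<^sub>M {..<n + 2} (\<lambda>_. lborel)) =
    (\<integral>\<^sup>+p. (\<integral>\<^sup>+y. f (restrict (hankel_lift p y) {..<n + 2}) \<partial>Pi\<^sub>M {..<n} (\<lambda>_. lborel)) \<partial>lborel)"
  using assms
proof (induction n arbitrary: f)
  case 0
  interpret product_sigma_finite "\<lambda>_. lborel :: real measure" by (rule product_sigma_finite_lborel)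
  note f[measurable] = 0[unfolded add_0]
  let ?g = "\<lambda>u v. f (\<lambda>i\<in>{..<2}. if i = 0 then u else v)"
  have two: "{..<2 :: nat} = {0, 1}" by auto
  have g: "case_prod ?g \<in> borel_measurable (lborel \<Otimes>\<^sub>M lborel)"
  proof -
    have "(\<lambda>(u, v). (\<lambda>i\<in>{..<2::nat}. if i = 0 then u else v)) \<in> measurable (lborel \<Otimes>\<^sub>M lborel) (Pi\<^sub>M {..<2} (\<lambda>_. lborel :: real measure))"
      unfolding case_prod_unfold by (rule measurable_restrict) auto
    from measurable_compose[OF this f] show ?thesis by (simp add: case_prod_unfold)
  qed
  have "(\<integral>\<^sup>+x. f x \<partial>Pi\<^sub>M {..<2} (\<lambda>_. lborel)) = (\<integral>\<^sup>+x. ?g (x 0) (x 1) \<partial>Pi\<^sub>M {..<2::nat} (\<lambda>_. lborel))"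
    by (intro nn_integral_cong arg_cong[where f = f])
       (auto simp: space_PiM PiE_def extensional_def fun_eq_iff less_2_cases_iff)
  also have "\<dots> = (\<integral>\<^sup>+z. ?g (fst z) (snd z) \<partial>(lborel \<Otimes>\<^sub>M lborel))"
    unfolding two by (rule product_nn_integral_pair[OF g[unfolded two]]) simp
  also have "\<dots> = (\<integral>\<^sup>+p. f (restrict (hankel_lift p (\<lambda>_. undefined)) {..<2}) \<partial>lborel)"
    unfolding lborel_prod
    by (intro nn_integral_cong arg_cong[where f = f]) (auto simp: fun_eq_iff less_2_cases_iff)
  finally show ?case
    by (simp add: PiM_empty nn_integral_count_space_finite numeral_2_eq_2 restrict_def)
next
  case (Suc n)
  interpret product_sigma_finite "\<lambda>_. lborel :: real measure" by (rule product_sigma_finite_lborel)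
  let ?P = "\<lambda>n. Pi\<^sub>M {..<n} (\<lambda>_. lborel :: real measure)"
  have ins: "{..<Suc m} = insert m {..<m}" for m :: nat by auto
  note f[measurable] = Suc.prems
  have f': "f \<in> borel_measurable (Pi\<^sub>M (insert (n + 2) {..<n + 2}) (\<lambda>_. lborel))"
    using f by (simp add: ins)
  have add: "(\<lambda>(x, t). x(n + 2 := t)) \<in> measurable (?P (n + 2) \<Otimes>\<^sub>M lborel) (?P (Suc n + 2))"
    using measurable_add_dim[of "n + 2" "{..<n + 2}" "\<lambda>_. lborel :: real measure"] by (simp add: ins)
  note fadd = measurable_compose[OF add f]
  have m1: "(\<lambda>x. \<integral>\<^sup>+t. f (x(n + 2 := t)) \<partial>lborel) \<in> borel_measurable (?P (n + 2))"
    using lborel.borel_measurable_nn_integral_fst[OF fadd] by (simp only: prod.case)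
  have "(\<integral>\<^sup>+x. f x \<partial>?P (Suc n + 2)) = (\<integral>\<^sup>+x. \<integral>\<^sup>+t. f (x(n + 2 := t)) \<partial>lborel \<partial>?P (n + 2))"
    using product_nn_integral_insert[OF _ _ f'] by (simp add: ins)
  also have "\<dots> = (\<integral>\<^sup>+p. \<integral>\<^sup>+y. \<integral>\<^sup>+t. f ((restrict (hankel_lift p y) {..<n + 2})(n + 2 := t)) \<partial>lborel \<partial>?P n \<partial>lborel)"
    by (rule Suc.IH[OF m1])
  also have "\<dots> = (\<integral>\<^sup>+p. \<integral>\<^sup>+y. f (restrict (hankel_lift p y) {..<Suc n + 2}) \<partial>?P (Suc n) \<partial>lborel)"
  proof (rule nn_integral_cong)
    fix p :: "real \<times> real"
    let ?F = "\<lambda>y. f (restrict (hankel_lift p y) {..<Suc n + 2})"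
    have F: "?F \<in> borel_measurable (Pi\<^sub>M (insert n {..<n}) (\<lambda>_. lborel))"
      using measurable_compose[OF measurable_hankel_lift[of "\<lambda>_. p" "?P (Suc n)" "\<lambda>y. y" "Suc n"] f]
      by (simp only: ins[of n] measurable_ident_sets borel_measurable_const)

    have "(\<integral>\<^sup>+y. ?F y \<partial>?P (Suc n)) = (\<integral>\<^sup>+y. \<integral>\<^sup>+t. ?F (y(n := t)) \<partial>lborel \<partial>?P n)"
      using product_nn_integral_insert[OF _ _ F] by (simp add: ins)
    also have "\<dots> = (\<integral>\<^sup>+y. \<integral>\<^sup>+t. f ((restrict (hankel_lift p y) {..<n + 2})(n + 2 := t)) \<partial>lborel \<partial>?P n)"
    proof (rule nn_integral_cong)
      fix y assume y: "y \<in> space (?P n)"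
      let ?x = "restrict (hankel_lift p y) {..<n + 2}"
      have "restrict (hankel_lift p (y(n := t))) {..<Suc n + 2} = ?x(n + 2 := - hankel_lift p y n + t)" for t
        by (auto simp: fun_eq_iff less_Suc_eq intro!: hankel_lift_cong)
      moreover have "(\<lambda>t. f (?x(n + 2 := t))) \<in> borel_measurable lborel"
      proof -
        have "?x \<in> space (?P (n + 2))" by (auto simp: space_PiM)
        from measurable_compose[OF measurable_Pair1'[OF this] fadd] show ?thesis by (simp only: prod.case)
      qed
      ultimately show "(\<integral>\<^sup>+t. ?F (y(n := t)) \<partial>lborel) = (\<integral>\<^sup>+t. f (?x(n + 2 := t)) \<partial>lborel)"
        using nn_integral_real_affine[of "\<lambda>t. f (?x(n + 2 := t))" 1 "- hankel_lift p y n"] by simp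
    qed
    finally show "(\<integral>\<^sup>+y. \<integral>\<^sup>+t. f ((restrict (hankel_lift p y) {..<n + 2})(n + 2 := t)) \<partial>lborel \<partial>?P n)
       = (\<integral>\<^sup>+y. ?F y \<partial>?P (Suc n))" ..
  qed
  finally show ?case .
qed

lemma sigma_finite_PiM_lborel: "sigma_finite_measure (Pi\<^sub>M {..<n :: nat} (\<lambda>_. lborel :: real measure))"
proof -
  interpret product_sigma_finite "\<lambda>_. lborel :: real measure" by (rule product_sigma_finite_lborel)
  show ?thesis by (rule sigma_finite) simp
qed

lemma distr_hankel_lift:
  "distr (Pi\<^sub>M {..<n} (\<lambda>_. lborel) \<Otimes>\<^sub>M lborel) (Pi\<^sub>M {..<n + 2} (\<lambda>_. lborel))
     (\<lambda>(y, p). restrict (hankel_lift p y) {..<n + 2}) = Pi\<^sub>M {..<n + 2} (\<lambda>_. lborel)"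
proof (rule measure_eqI)
  let ?P = "\<lambda>n. Pi\<^sub>M {..<n :: nat} (\<lambda>_. lborel :: real measure)"
  let ?T = "\<lambda>(y, p). restrict (hankel_lift p y) {..<n + 2}"
  interpret P: sigma_finite_measure "?P n" by (rule sigma_finite_PiM_lborel)
  interpret pair_sigma_finite "?P n" "lborel :: (real \<times> real) measure" by standard
  have T[measurable]: "?T \<in> measurable (?P n \<Otimes>\<^sub>M lborel) (?P (n + 2))"
    unfolding case_prod_unfold by (rule measurable_hankel_lift) auto
  fix A assume "A \<in> sets (distr (?P n \<Otimes>\<^sub>M lborel) (?P (n + 2)) ?T)"
  then have A[measurable]: "A \<in> sets (?P (n + 2))" by simp
  have "emeasure (distr (?P n \<Otimes>\<^sub>M lborel) (?P (n + 2)) ?T) A =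
      (\<integral>\<^sup>+z. indicator A z \<partial>distr (?P n \<Otimes>\<^sub>M lborel) (?P (n + 2)) ?T)"
    by (rule nn_integral_indicator[symmetric]) (simp only: sets_distr A)
  also have "\<dots> = (\<integral>\<^sup>+z. indicator A (?T z) \<partial>(?P n \<Otimes>\<^sub>M lborel))"
    by (rule nn_integral_distr) measurable
  also have "\<dots> = (\<integral>\<^sup>+p. \<integral>\<^sup>+y. indicator A (?T (y, p)) \<partial>?P n \<partial>lborel)"
    by (rule nn_integral_snd[symmetric]) measurable
  also have "\<dots> = (\<integral>\<^sup>+x. indicator A x \<partial>?P (n + 2))"
    by (simp only: nn_integral_hankel_lift[OF borel_measurable_indicator[OF A]] prod.case)
  finally show "emeasure (distr (?P n \<Otimes>\<^sub>M lborel) (?P (n + 2)) ?T) A = emeasure (?P (n + 2)) A"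
    by (simp only: nn_integral_indicator[OF A])
qed simp

text \<open>
  The part of the disc above height \<open>t\<close> is a disc of area \<open>\<pi> (R\<^sup>2 - t / A)\<close>, and this is affine in \<open>t\<close>. So
  the heights of the paraboloid are uniformly distributed, and integrals of functions of \<open>h\<close>
  over the disc become integrals over an interval.
\<close>

lemma distr_paraboloid:
  fixes c :: "real \<times> real" and A R :: real
  assumes "A > 0" "R > 0"
  defines "h \<equiv> \<lambda>p. A * (R\<^sup>2 - ((fst p - fst c)\<^sup>2 + (snd p - snd c)\<^sup>2))"
  shows "distr (density lborel (indicator {p. h p > 0})) borel h =
           density lborel (\<lambda>t. ennreal (pi / A) * indicator {0<..<A * R\<^sup>2} t)"
proof (rule measure_eqI_lessThan)
  have h[measurable]: "h \<in> borel_measurable borel"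
    unfolding h_def borel_prod[symmetric] by measurable
  have S: "{p. h p > 0} \<in> sets borel" by measurable
  fix t :: real
  define r where "r = R\<^sup>2 - max t 0 / A"
  have set: "{p. h p > 0} \<inter> h -` {t<..} = (if r > 0 then ball c (sqrt r) else {})"
  proof -
    have "h p > 0 \<and> h p > t \<longleftrightarrow> (dist c p)\<^sup>2 < r" for p
    proof -
      have "h p = A * (R\<^sup>2 - (dist c p)\<^sup>2)"
        by (simp add: h_def dist_prod_def dist_real_def power2_commute)
      moreover have "h p > 0 \<and> h p > t \<longleftrightarrow> h p > max t 0" by auto
      ultimately show ?thesis using \<open>A > 0\<close> by (auto simp: r_def field_simps)
    qed
    moreover have "(dist c p)\<^sup>2 < r \<longleftrightarrow> r > 0 \<and> dist c p < sqrt r" for p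
      by (metis abs_of_nonneg less_le_trans not_le real_less_rsqrt real_sqrt_abs real_sqrt_gt_0_iff real_sqrt_less_iff zero_le_dist zero_le_power2)
    ultimately have "h p > 0 \<and> h p > t \<longleftrightarrow> r > 0 \<and> dist c p < sqrt r" for p
      by simp
    then have "{p. h p > 0} \<inter> h -` {t<..} = {p. r > 0 \<and> dist c p < sqrt r}"
      by (simp only: vimage_def Collect_conj_eq[symmetric] greaterThan_def mem_Collect_eq)
    then show ?thesis by (simp add: ball_def)
  qed
  have "emeasure (distr (density lborel (indicator {p. h p > 0})) borel h) {t<..}
      = emeasure lborel ({p. h p > 0} \<inter> h -` {t<..})"
    using S measurable_sets_borel[OF h, of "{t<..}"]
    by (subst emeasure_distr) (auto simp: emeasure_restricted)
  also have "\<dots> = ennreal (pi * max 0 r)"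
    unfolding set by (auto simp: emeasure_ball unit_ball_vol_2 max_def)
  finally have L: "emeasure (distr (density lborel (indicator {p. h p > 0})) borel h) {t<..} = ennreal (pi * max 0 r)" .
  show "emeasure (distr (density lborel (indicator {p. h p > 0})) borel h) {t<..} < \<infinity>"
    unfolding L by simp
  have "emeasure (density lborel (\<lambda>t. ennreal (pi / A) * indicator {0<..<A * R\<^sup>2} t)) {t<..}
      = (\<integral>\<^sup>+x. ennreal (pi / A) * indicator {max t 0<..<A * R\<^sup>2} x \<partial>lborel)"
    by (subst emeasure_density) (auto intro!: nn_integral_cong simp: indicator_def)
  also have "\<dots> = ennreal (pi / A) * ennreal (max 0 (A * R\<^sup>2 - max t 0))"
    by (subst nn_integral_cmult_indicator) (auto simp: max_def)
  also have "\<dots> = ennreal (pi * max 0 r)"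
    using \<open>A > 0\<close> by (auto simp: r_def max_def field_simps simp flip: ennreal_mult)
  finally show "emeasure (distr (density lborel (indicator {p. h p > 0})) borel h) {t<..} =
    emeasure (density lborel (\<lambda>t. ennreal (pi / A) * indicator {0<..<A * R\<^sup>2} t)) {t<..}"
    unfolding L ..
qed auto

section \<open>Integrals of complex powers\<close>

lemma has_bochner_integral_lborel_has_integral:
  fixes f :: "real \<Rightarrow> complex"
  assumes f: "f \<in> borel_measurable borel" and I: "(f has_integral I) UNIV"
    and J: "((\<lambda>x. norm (f x)) has_integral J) UNIV"
  shows "has_bochner_integral lborel f I"
proof -
  have "integral\<^sup>N lborel (\<lambda>x. norm (f x)) = J"
    using f by (intro nn_integral_has_integral_lborel J) auto
  then have int: "integrable lborel f"
    using f by (intro integrableI_bounded) auto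
  then have "integral\<^sup>L lborel f = I"
    using has_integral_integral_lborel I has_integral_unique by blast
  with int show ?thesis by (simp add: has_bochner_integral_iff)
qed

text \<open>
  For \<open>t > 0\<close> this is \<open>t powr a\<close>. The form with the real logarithm is visibly measurable, and both the norm
  and the exponent law become statements about \<open>exp\<close>.
\<close>

definition cpow :: "real \<Rightarrow> complex \<Rightarrow> complex" where
  "cpow t a = exp (a * of_real (ln t))"

lemma cpow_eq_powr: "t > 0 \<Longrightarrow> cpow t a = complex_of_real t powr a"
  by (simp add: cpow_def powr_def Ln_of_real)

lemma cpow_measurable [measurable]: "f \<in> borel_measurable M \<Longrightarrow> (\<lambda>x. cpow (f x) a) \<in> borel_measurable M"
  unfolding cpow_def by measurable

text \<open>
  Norms are again powers, with the real part of the exponent. Every computation of an integral below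
  therefore also computes the integral of the norm.
\<close>

lemma norm_cpow: "complex_of_real (norm (cpow t a)) = cpow t (of_real (Re a))"
  by (simp add: cpow_def norm_exp_eq_Re exp_of_real flip: of_real_mult)

lemma cpow_add: "cpow t (a + b) = cpow t a * cpow t b"
  by (simp add: cpow_def exp_add ring_distribs)

lemma has_bochner_integral_cpow:
  assumes "Re a > -1" "L > 0"
  shows "has_bochner_integral lborel (\<lambda>t. indicator {0<..<L} t *\<^sub>R cpow t a) (cpow L (a + 1) / (a + 1))"
proof -
  have base: "((\<lambda>t. indicator {0<..<L} t *\<^sub>R cpow t a) has_integral cpow L (a + 1) / (a + 1)) UNIV"
    if "Re a > -1" for a
  proof -
    have "a + 1 \<noteq> 0" using that by (metis add.commute add_eq_0_iff Re_complex_of_real less_irrefl of_real_1 uminus_complex.sel(1))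
    then have "((\<lambda>t. complex_of_real t powr a) has_integral
            (of_real L powr (a + 1) / (a + 1) - of_real 0 powr (a + 1) / (a + 1))) {0..L}"
      using that \<open>L > 0\<close>
      by (intro fundamental_theorem_of_calculus_interior)
         (auto intro!: continuous_intros derivative_eq_intros has_vector_derivative_real_field)
    then have "((\<lambda>t. complex_of_real t powr a) has_integral cpow L (a + 1) / (a + 1)) {0<..<L}"
      using \<open>L > 0\<close> by (simp add: has_integral_Icc_iff_Ioo cpow_eq_powr)
    then have "((\<lambda>t. if t \<in> {0<..<L} then complex_of_real t powr a else 0) has_integral cpow L (a + 1) / (a + 1)) UNIV"
      by (simp only: has_integral_restrict_UNIV)
    then show ?thesis
      by (rule has_integral_eq[rotated]) (auto simp: cpow_eq_powr indicator_def)
  qed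
  have "((\<lambda>t. Re (indicator {0<..<L} t *\<^sub>R cpow t (of_real (Re a)))) has_integral
      Re (cpow L (of_real (Re a) + 1) / (of_real (Re a) + 1))) UNIV"
    using has_integral_linear[OF base[of "of_real (Re a)"] bounded_linear_Re] assms by (simp add: o_def)
  then have "((\<lambda>t. norm (indicator {0<..<L} t *\<^sub>R cpow t a)) has_integral
      Re (cpow L (of_real (Re a) + 1) / (of_real (Re a) + 1))) UNIV"
    by (rule has_integral_eq[rotated]) (auto simp: indicator_def simp flip: norm_cpow)
  then show ?thesis
    by (intro has_bochner_integral_lborel_has_integral base assms(1)) measurable
qed

lemma has_bochner_integral_Gamma:
  assumes "Re a > -1"
  shows "has_bochner_integral lborel (\<lambda>t. indicator {0<..} t *\<^sub>R (of_real (exp (- t)) * cpow t a)) (Gamma (a + 1))"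
proof -
  have base: "((\<lambda>t. indicator {0<..} t *\<^sub>R (of_real (exp (- t)) * cpow t a)) has_integral Gamma (a + 1)) UNIV"
    if "Re a > -1" for a
  proof -
    have "((\<lambda>t. complex_of_real t powr a / of_real (exp t)) has_integral Gamma (a + 1)) {0..}"
      using Gamma_integral_complex[of "a + 1"] that by simp
    then have "((\<lambda>t. if t \<in> {0..} then complex_of_real t powr a / of_real (exp t) else 0) has_integral Gamma (a + 1)) UNIV"
      by (simp only: has_integral_restrict_UNIV)
    then show ?thesis
      by (rule has_integral_eq[rotated]) (auto simp: cpow_eq_powr indicator_def exp_minus field_simps)
  qed
  have "((\<lambda>t. Re (indicator {0<..} t *\<^sub>R (of_real (exp (- t)) * cpow t (of_real (Re a))))) has_integral
      Re (Gamma (of_real (Re a) + 1))) UNIV"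
    using has_integral_linear[OF base[of "of_real (Re a)"] bounded_linear_Re] assms by (simp add: o_def)
  then have "((\<lambda>t. norm (indicator {0<..} t *\<^sub>R (of_real (exp (- t)) * cpow t a))) has_integral
      Re (Gamma (of_real (Re a) + 1))) UNIV"
    by (rule has_integral_eq[rotated]) (auto simp: indicator_def norm_mult simp flip: norm_cpow of_real_mult)
  then show ?thesis
    by (intro has_bochner_integral_lborel_has_integral base assms(1)) measurable
qed

lemma has_bochner_integral_paraboloid:
  fixes c :: "real \<times> real" and A R :: real
  assumes A: "A > 0" and R: "R > 0" and a: "Re a > -1"
  defines "h \<equiv> \<lambda>p. A * (R\<^sup>2 - ((fst p - fst c)\<^sup>2 + (snd p - snd c)\<^sup>2))"
  shows "has_bochner_integral lborel (\<lambda>p. indicator {p. h p > 0} p *\<^sub>R cpow (h p) a)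
           (of_real (pi / A) * (cpow (A * R\<^sup>2) (a + 1) / (a + 1)))"
proof -
  have h[measurable]: "h \<in> borel_measurable borel"
    unfolding h_def borel_prod[symmetric] by measurable
  have S[measurable]: "{p. h p > 0} \<in> sets borel" by measurable
  let ?X = "of_real (pi / A) * (cpow (A * R\<^sup>2) (a + 1) / (a + 1))"
  let ?D = "density lborel (indicator {p. h p > 0}) :: (real \<times> real) measure"
  have "has_bochner_integral lborel (\<lambda>t. complex_of_real (pi / A) * (indicator {0<..<A * R\<^sup>2} t *\<^sub>R cpow t a)) ?X"
    using A R by (intro has_bochner_integral_mult_right has_bochner_integral_cpow a) auto
  then have "has_bochner_integral lborel (\<lambda>t. (pi / A * indicator {0<..<A * R\<^sup>2} t) *\<^sub>R cpow t a) ?X"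
    by (simp add: scaleR_conv_of_real mult.assoc)
  then have "has_bochner_integral (density lborel (\<lambda>t. pi / A * indicator {0<..<A * R\<^sup>2} t)) (\<lambda>t. cpow t a) ?X"
    using A by (intro has_bochner_integral_density) auto
  also have "density lborel (\<lambda>t. ennreal (pi / A * indicator {0<..<A * R\<^sup>2} t)) = distr ?D borel h"
    unfolding h_def distr_paraboloid[OF A R]
    by (intro density_cong) (use A in \<open>auto simp: indicator_def\<close>)
  finally have "has_bochner_integral ?D (\<lambda>p. cpow (h p) a) ?X"
    by (simp add: has_bochner_integral_iff integrable_distr_eq integral_distr)
  moreover have "?D = density lborel (\<lambda>p. ennreal (indicator {p. h p > 0} p))"
    by (simp add: ennreal_indicator)
  ultimately show ?thesis
    by (simp add: has_bochner_integral_iff integrable_density integral_density)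
qed

section \<open>Recursion for the integrals over the cone\<close>

lemma hankel_det_cong: "(\<And>k. k < 2 * m - 1 \<Longrightarrow> x k = x' k) \<Longrightarrow> hankel_det m x = hankel_det m x'"
  by (auto simp: hankel_det_def hankel_mat_def intro!: arg_cong[where f = Determinant.det] eq_matI)

lemma hankel_fold_cong:
  "(\<And>k. k < 2 * m + 1 \<Longrightarrow> x k = x' k) \<Longrightarrow> k < 2 * m - 1 \<Longrightarrow> hankel_fold x k = hankel_fold x' k"
  by (auto simp: hankel_fold_def)

lemma hankel_pos_cong: "(\<And>k. k < 2 * m - 1 \<Longrightarrow> x k = x' k) \<Longrightarrow> hankel_pos m x \<longleftrightarrow> hankel_pos m x'"
proof (induction m arbitrary: x x')
  case (Suc m)
  have "hankel_pos m (hankel_fold x) \<longleftrightarrow> hankel_pos m (hankel_fold x')"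
    by (rule Suc.IH, rule hankel_fold_cong[of m]) (use Suc.prems in auto)
  moreover have "hankel_det (Suc m) x = hankel_det (Suc m) x'"
    using Suc.prems by (intro hankel_det_cong) auto
  ultimately show ?case by simp
qed simp

lemma hankel_form_cong:
  "m \<ge> 1 \<Longrightarrow> (\<And>k. k < 2 * m - 1 \<Longrightarrow> x k = x' k) \<Longrightarrow> hankel_form m x = hankel_form m x'"
  by (auto simp: hankel_form_def intro!: sum.cong)

text \<open>
  \<open>L((1 + t\<^sup>2)\<^sup>n\<^sup>+\<^sup>1) = L((1 + t\<^sup>2) (1 + t\<^sup>2)\<^sup>n)\<close>, that is, Pascal's rule.
\<close>

lemma hankel_form_fold: "hankel_form (n + 2) x = hankel_form (n + 1) (hankel_fold x)"
proof -
  have shift: "(\<Sum>j\<le>Suc n. real (n choose j) * x (2 * j)) = x 0 + (\<Sum>j\<le>n. real (n choose Suc j) * x (2 * j + 2))"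
    by (subst sum.atMost_Suc_shift) simp
  have "hankel_form (n + 2) x = (\<Sum>j\<le>Suc n. real (Suc n choose j) * x (2 * j))"
    by (simp add: hankel_form_def atLeast0AtMost del: binomial_Suc_Suc)
  also have "\<dots> = x 0 + (\<Sum>j\<le>n. real (n choose j) * x (2 * j + 2)) + (\<Sum>j\<le>n. real (n choose Suc j) * x (2 * j + 2))"
    by (subst sum.atMost_Suc_shift) (simp add: ring_distribs sum.distrib)
  also have "x 0 + (\<Sum>j\<le>n. real (n choose j) * x (2 * j + 2)) + (\<Sum>j\<le>n. real (n choose Suc j) * x (2 * j + 2))
     = (\<Sum>j\<le>n. real (n choose j) * x (2 * j + 2)) + (\<Sum>j\<le>Suc n. real (n choose j) * x (2 * j))"
    by (simp only: shift add_ac)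
  also have "\<dots> = hankel_form (n + 1) (hankel_fold x)"
    by (simp add: hankel_form_def hankel_fold_def atLeast0AtMost ring_distribs sum.distrib)
  finally show ?thesis .
qed

lemma measurable_hankel_det:
  assumes "\<And>k. k < 2 * m - 1 \<Longrightarrow> (\<lambda>\<omega>. X \<omega> k) \<in> borel_measurable M"
  shows "(\<lambda>\<omega>. hankel_det m (X \<omega>)) \<in> borel_measurable M"
proof -
  have "hankel_det m x = (\<Sum>p | p permutes {0..<m}. signof p * (\<Prod>i = 0..<m. x (i + p i)))" for x
    unfolding hankel_det_def
    by (subst det_def'[of _ m])
       (auto simp: hankel_mat_def permutes_in_image intro!: sum.cong prod.cong)
  moreover have "(\<lambda>\<omega>. X \<omega> (i + p i)) \<in> borel_measurable M" if "p permutes {0..<m}" "i < m" for p i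
  proof (rule assms)
    have "p i < m" using that permutes_in_image[OF that(1), of i] by simp
    then show "i + p i < 2 * m - 1" using \<open>i < m\<close> by linarith
  qed
  ultimately show ?thesis by simp
qed

lemma measurable_hankel_fold:
  assumes "\<And>k. k < 2 * m + 1 \<Longrightarrow> (\<lambda>\<omega>. X \<omega> k) \<in> borel_measurable M" "k < 2 * m - 1"
  shows "(\<lambda>\<omega>. hankel_fold (X \<omega>) k) \<in> borel_measurable M"
  unfolding hankel_fold_def using assms by (intro borel_measurable_add) auto

lemma measurable_hankel_pos:
  assumes "\<And>k. k < 2 * m - 1 \<Longrightarrow> (\<lambda>\<omega>. X \<omega> k) \<in> borel_measurable M"
  shows "Measurable.pred M (\<lambda>\<omega>. hankel_pos m (X \<omega>))"
  using assms
proof (induction m arbitrary: X)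
  case (Suc m)
  have [measurable]: "(\<lambda>\<omega>. hankel_det (Suc m) (X \<omega>)) \<in> borel_measurable M"
    by (rule measurable_hankel_det) (use Suc.prems in auto)
  have [measurable]: "Measurable.pred M (\<lambda>\<omega>. hankel_pos m (hankel_fold (X \<omega>)))"
    by (rule Suc.IH, rule measurable_hankel_fold[of m]) (use Suc.prems in auto)
  show ?case by simp
qed simp

text \<open>
  The family of integrands that is closed under integration over the fibres. The index is \<open>n = m - 1\<close>,
  so the ambient dimension is \<open>2 n + 1\<close>; the indicator of the cone is part of the function.
\<close>

definition hankel_kernel :: "nat \<Rightarrow> complex \<Rightarrow> complex \<Rightarrow> (nat \<Rightarrow> real) \<Rightarrow> complex" where
  "hankel_kernel n a b x = of_bool (hankel_pos (n + 1) x) * of_real (exp (- hankel_form (n + 1) x)) *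
     cpow (hankel_det (n + 1) x) a * cpow (hankel_det n (hankel_fold x)) b"

lemma hankel_kernel_cong:
  assumes "\<And>k. k < 2 * n + 1 \<Longrightarrow> x k = x' k"
  shows "hankel_kernel n a b x = hankel_kernel n a b x'"
proof -
  have "hankel_det n (hankel_fold x) = hankel_det n (hankel_fold x')"
    by (rule hankel_det_cong, rule hankel_fold_cong[of n]) (use assms in auto)
  moreover have "hankel_det (n + 1) x = hankel_det (n + 1) x'" "hankel_pos (n + 1) x \<longleftrightarrow> hankel_pos (n + 1) x'"
    "hankel_form (n + 1) x = hankel_form (n + 1) x'"
    using assms by (intro hankel_det_cong hankel_pos_cong hankel_form_cong; simp)+
  ultimately show ?thesis by (simp only: hankel_kernel_def)
qed

lemma measurable_hankel_kernel [measurable]: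
  "hankel_kernel n a b \<in> borel_measurable (Pi\<^sub>M {..<2 * n + 1} (\<lambda>_. lborel))"
proof -
  let ?M = "Pi\<^sub>M {..<2 * n + 1} (\<lambda>_. lborel :: real measure)"
  have comp: "(\<lambda>x. x k) \<in> borel_measurable ?M" if "k < 2 * n + 1" for k
    using measurable_component_singleton[of k "{..<2 * n + 1}" "\<lambda>_. lborel :: real measure"] that by simp
  have [measurable]: "hankel_det (n + 1) \<in> borel_measurable ?M"
    using measurable_hankel_det[of "n + 1" "\<lambda>x. x" ?M] comp by simp
  have [measurable]: "Measurable.pred ?M (hankel_pos (n + 1))"
    using measurable_hankel_pos[of "n + 1" "\<lambda>x. x" ?M] comp by (simp del: hankel_pos.simps)
  have [measurable]: "(\<lambda>x. hankel_det n (hankel_fold x)) \<in> borel_measurable ?M"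
    by (rule measurable_hankel_det, rule measurable_hankel_fold[of n]) (use comp in auto)
  have [measurable]: "hankel_form (n + 1) \<in> borel_measurable ?M"
    unfolding hankel_form_def using comp by (intro borel_measurable_sum borel_measurable_times) auto
  show ?thesis
    unfolding hankel_kernel_def by measurable
qed

lemma norm_hankel_kernel:
  "complex_of_real (norm (hankel_kernel n a b x)) = hankel_kernel n (of_real (Re a)) (of_real (Re b)) x"
  by (simp add: hankel_kernel_def norm_mult norm_cpow)

text \<open>The constant \<open>\<pi> / ((a + 1) 2\<^sup>2\<^sup>a\<^sup>+\<^sup>2)\<close> that each integration over a disc contributes.\<close>

definition fold_factor :: "complex \<Rightarrow> complex" where
  "fold_factor a = of_real pi / ((a + 1) * 2 powr (2 * a + 2))"

text \<open>
  With \<open>A = f\<^sub>n(z)\<close>, \<open>B = f\<^sub>n\<^sub>+\<^sub>1(y)\<close> and \<open>R = B / (2 A)\<close> the paraboloid integral is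
  \<open>\<pi> / A\<close> times \<open>(A R\<^sup>2)\<^sup>a\<^sup>+\<^sup>1 / (a + 1)\<close>, where \<open>A R\<^sup>2 = B\<^sup>2 / (4 A)\<close>.
\<close>

lemma has_bochner_integral_hankel_kernel_fibre:
  assumes a: "Re a > -1"
  shows "has_bochner_integral lborel (\<lambda>p. hankel_kernel (n + 1) a b (hankel_lift p y))
           (fold_factor a * hankel_kernel n (2 * a + 2 + b) (- a - 2) y)"
proof (cases "hankel_pos (n + 1) y")
  case False
  then have "hankel_kernel (n + 1) a b (hankel_lift p y) = 0" for p
    by (simp add: hankel_kernel_def)
  moreover have "hankel_kernel n (2 * a + 2 + b) (- a - 2) y = 0"
    unfolding hankel_kernel_def using False by (simp del: hankel_pos.simps)
  ultimately show ?thesis by (simp add: has_bochner_integral_zero)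
next
  case True
  define A where "A = hankel_det n (hankel_fold y)"
  define B where "B = hankel_det (n + 1) y"
  define R where "R = B / (2 * A)"
  have A: "A > 0" using True hankel_pos_det by (auto simp: A_def)
  have B: "B > 0" using True by (auto simp: B_def)
  have R: "R > 0" using A B by (simp add: R_def)
  obtain c :: "real \<times> real" where c: "\<And>x. hankel_fold x = y \<Longrightarrow>
     hankel_det (n + 2) x = A * (R\<^sup>2 - ((x 0 - fst c)\<^sup>2 + (x 1 - snd c)\<^sup>2))"
    using hankel_det_paraboloid[of n y] A unfolding A_def B_def R_def by (metis less_irrefl)
  define h where "h p = A * (R\<^sup>2 - ((fst p - fst c)\<^sup>2 + (snd p - snd c)\<^sup>2))" for p
  have det: "hankel_det (n + 2) (hankel_lift p y) = h p" for p
    using c[of "hankel_lift p y"] by (simp add: h_def)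
  define E where "E = complex_of_real (exp (- hankel_form (n + 1) y)) * cpow B b"
  have "hankel_kernel (n + 1) a b (hankel_lift p y) = E * (indicator {p. h p > 0} p *\<^sub>R cpow (h p) a)" for p
    using det[of p] True hankel_form_fold[of n "hankel_lift p y"]
    by (simp add: hankel_kernel_def E_def B_def)
  moreover have "has_bochner_integral lborel (\<lambda>p. E * (indicator {p. h p > 0} p *\<^sub>R cpow (h p) a))
      (E * (of_real (pi / A) * (cpow (A * R\<^sup>2) (a + 1) / (a + 1))))"
    unfolding h_def by (intro has_bochner_integral_mult_right has_bochner_integral_paraboloid A R a)
  moreover have "E * (of_real (pi / A) * (cpow (A * R\<^sup>2) (a + 1) / (a + 1))) =
      fold_factor a * hankel_kernel n (2 * a + 2 + b) (- a - 2) y"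
  proof -
    have scale: "cpow (A * R\<^sup>2) (a + 1) / of_real A = cpow B (2 * a + 2) * cpow A (- a - 2) / 2 powr (2 * a + 2)"
    proof -
      have lnA: "complex_of_real A = exp (of_real (ln A))" using A by (simp add: exp_of_real)
      have pow: "2 powr (2 * a + 2) = exp ((2 * a + 2) * of_real (ln 2))"
        using cpow_eq_powr[of 2 "2 * a + 2"] by (simp add: cpow_def)
      have lnR: "ln (A * R\<^sup>2) = 2 * ln B - 2 * ln 2 - ln A"
        using A B by (simp add: R_def ln_mult ln_div ln_realpow)
      show ?thesis
        unfolding cpow_def pow lnR by (subst lnA) (simp add: algebra_simps flip: exp_add exp_diff)
    qed
    have kernel: "hankel_kernel n (2 * a + 2 + b) (- a - 2) y = E * cpow B (2 * a + 2) * cpow A (- a - 2)"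
      unfolding hankel_kernel_def E_def A_def[symmetric] B_def[symmetric] cpow_add[of B "2 * a + 2" b]
      using True by (simp del: hankel_pos.simps)
    have "E * (of_real (pi / A) * (cpow (A * R\<^sup>2) (a + 1) / (a + 1))) =
        E * of_real pi * (cpow (A * R\<^sup>2) (a + 1) / of_real A) / (a + 1)"
      by simp
    also have "\<dots> = fold_factor a * hankel_kernel n (2 * a + 2 + b) (- a - 2) y"
      unfolding scale kernel fold_factor_def by (simp add: mult_ac)
    finally show ?thesis .
  qed
  ultimately show ?thesis by simp
qed

text \<open>
  Fubini over the fibres. The integral of the norm over a fibre is, by \<open>norm_hankel_kernel\<close>, the fibre integral for
  the real parts of the exponents, hence a multiple of the norm of the smaller kernel.
\<close>

lemma has_bochner_integral_hankel_kernel_step: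
  assumes a: "Re a > -1"
    and int: "has_bochner_integral (Pi\<^sub>M {..<2 * n + 1} (\<lambda>_. lborel)) (hankel_kernel n (2 * a + 2 + b) (- a - 2)) V"
  shows "has_bochner_integral (Pi\<^sub>M {..<2 * (n + 1) + 1} (\<lambda>_. lborel)) (hankel_kernel (n + 1) a b) (fold_factor a * V)"
proof -
  let ?P = "\<lambda>n. Pi\<^sub>M {..<n :: nat} (\<lambda>_. lborel :: real measure)"
  let ?N = "2 * n + 1"
  let ?T = "\<lambda>(y, p). restrict (hankel_lift p y) {..<?N + 2}"
  let ?G = "\<lambda>(y, p). hankel_kernel (n + 1) a b (hankel_lift p y)"
  have N: "2 * (n + 1) + 1 = ?N + 2" by simp
  interpret P: sigma_finite_measure "?P ?N" by (rule sigma_finite_PiM_lborel)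
  interpret pair_sigma_finite "?P ?N" "lborel :: (real \<times> real) measure" by standard
  have T: "?T \<in> measurable (?P ?N \<Otimes>\<^sub>M lborel) (?P (?N + 2))"
    unfolding case_prod_unfold by (rule measurable_hankel_lift) auto
  have K: "hankel_kernel (n + 1) a b \<in> borel_measurable (?P (?N + 2))"
    using measurable_hankel_kernel[of "n + 1" a b] by (simp only: N)
  have GT: "hankel_kernel (n + 1) a b (?T z) = ?G z" for z
    by (cases z) (auto intro: hankel_kernel_cong)
  have G: "?G \<in> borel_measurable (?P ?N \<Otimes>\<^sub>M lborel)"
    using measurable_compose[OF T K] by (simp only: GT)
  have fibre: "has_bochner_integral lborel (\<lambda>p. ?G (y, p)) (fold_factor a * hankel_kernel n (2 * a + 2 + b) (- a - 2) y)" for y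
    using has_bochner_integral_hankel_kernel_fibre[OF a] by simp
  have "(\<integral>p. norm (?G (y, p)) \<partial>lborel) =
      norm (fold_factor (of_real (Re a))) * norm (hankel_kernel n (2 * a + 2 + b) (- a - 2) y)" for y
  proof -
    have "has_bochner_integral lborel (\<lambda>p. complex_of_real (norm (?G (y, p))))
        (fold_factor (of_real (Re a)) * of_real (norm (hankel_kernel n (2 * a + 2 + b) (- a - 2) y)))"
      using has_bochner_integral_hankel_kernel_fibre[of "of_real (Re a)" n "of_real (Re b)" y] a
      by (simp add: norm_hankel_kernel)
    then have eq: "complex_of_real (\<integral>p. norm (?G (y, p)) \<partial>lborel) =
        fold_factor (of_real (Re a)) * of_real (norm (hankel_kernel n (2 * a + 2 + b) (- a - 2) y))"
      by (metis has_bochner_integral_iff integral_complex_of_real)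
    have "norm (complex_of_real (\<integral>p. norm (?G (y, p)) \<partial>lborel)) = (\<integral>p. norm (?G (y, p)) \<partial>lborel)"
      by (simp add: Bochner_Integration.integral_nonneg)
    then show ?thesis
      unfolding eq by (simp add: norm_mult)
  qed
  moreover have "integrable (?P ?N) (\<lambda>y. norm (fold_factor (of_real (Re a))) * norm (hankel_kernel n (2 * a + 2 + b) (- a - 2) y))"
    using int by (intro integrable_mult_right integrable_norm) (simp add: has_bochner_integral_iff)
  ultimately have intG: "integrable (?P ?N \<Otimes>\<^sub>M lborel) ?G"
    using fibre by (intro Fubini_integrable G) (auto simp: has_bochner_integral_iff)
  have "(\<integral>z. ?G z \<partial>(?P ?N \<Otimes>\<^sub>M lborel)) = (\<integral>y. (\<integral>p. ?G (y, p) \<partial>lborel) \<partial>?P ?N)"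
    by (rule integral_fst'[OF intG, symmetric])
  also have "\<dots> = (\<integral>y. fold_factor a * hankel_kernel n (2 * a + 2 + b) (- a - 2) y \<partial>?P ?N)"
    using fibre by (simp add: has_bochner_integral_iff)
  also have "\<dots> = fold_factor a * V"
    using int by (simp add: has_bochner_integral_iff)
  finally have "has_bochner_integral (?P ?N \<Otimes>\<^sub>M lborel) (\<lambda>z. hankel_kernel (n + 1) a b (?T z)) (fold_factor a * V)"
    using intG by (simp only: has_bochner_integral_iff GT)
  then have "has_bochner_integral (distr (?P ?N \<Otimes>\<^sub>M lborel) (?P (?N + 2)) ?T) (hankel_kernel (n + 1) a b) (fold_factor a * V)"
    using T K by (simp only: has_bochner_integral_iff integrable_distr_eq integral_distr)
  then show ?thesis
    by (simp only: N distr_hankel_lift)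
qed

lemma has_bochner_integral_hankel_kernel_0:
  assumes "Re a > -1"
  shows "has_bochner_integral (Pi\<^sub>M {..<1} (\<lambda>_. lborel)) (hankel_kernel 0 a b) (Gamma (a + 1))"
proof -
  interpret product_sigma_finite "\<lambda>_. lborel :: real measure" by (rule product_sigma_finite_lborel)
  have one: "{..<1 :: nat} = {0}" by auto
  have D: "distr lborel (Pi\<^sub>M {0} (\<lambda>_. lborel)) (\<lambda>t. \<lambda>i\<in>{0}. t) = Pi\<^sub>M {0 :: nat} (\<lambda>_. lborel :: real measure)"
    by (rule distr_component)
  have m: "(\<lambda>t. \<lambda>i\<in>{0}. t) \<in> measurable lborel (Pi\<^sub>M {0 :: nat} (\<lambda>_. lborel :: real measure))"
    by (rule measurable_restrict) simp
  have K: "hankel_kernel 0 a b \<in> borel_measurable (Pi\<^sub>M {0 :: nat} (\<lambda>_. lborel :: real measure))"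
    using measurable_hankel_kernel[of 0 a b] by (simp only: one mult_0_right add_0)
  have "hankel_kernel 0 a b (\<lambda>i\<in>{0}. t) = indicator {0<..} t *\<^sub>R (of_real (exp (- t)) * cpow t a)" for t
    by (simp add: hankel_kernel_def hankel_form_def cpow_def)
  then have "has_bochner_integral lborel (\<lambda>t. hankel_kernel 0 a b (\<lambda>i\<in>{0}. t)) (Gamma (a + 1))"
    using has_bochner_integral_Gamma[OF assms] by simp
  then have "has_bochner_integral (distr lborel (Pi\<^sub>M {0} (\<lambda>_. lborel)) (\<lambda>t. \<lambda>i\<in>{0}. t)) (hankel_kernel 0 a b) (Gamma (a + 1))"
    using m K by (simp only: has_bochner_integral_iff integrable_distr_eq integral_distr)
  then show ?thesis unfolding D one .
qed

text \<open>
  With \<open>\<tau> = s + 2\<close> the exponents are \<open>a j = j \<tau> - 2\<close> and \<open>b j = - (j - 1) \<tau>\<close>. They satisfy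
  \<open>2 a j + 2 + b j = a (j + 1)\<close> and \<open>- a j - 2 = b (j + 1)\<close>, so one step of the recursion shifts \<open>j\<close> by one;
  the induction has to vary \<open>j\<close>, although only \<open>j = 1\<close> with \<open>a 1 = s\<close> and \<open>b 1 = 0\<close> is wanted in the end.
\<close>

lemma has_bochner_integral_hankel_kernel:
  fixes s :: complex
  assumes s: "Re s > 0" and "j \<ge> 1"
  defines "a \<equiv> \<lambda>j. of_nat j * s + 2 * (of_nat j - 1)" and "b \<equiv> \<lambda>j. - (of_nat j - 1) * (s + 2)"
  shows "has_bochner_integral (Pi\<^sub>M {..<2 * n + 1} (\<lambda>_. lborel)) (hankel_kernel n (a j) (b j))
     ((\<Prod>i = j..<j + n. fold_factor (a i)) * Gamma (a (j + n) + 1))"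
proof -
  have a1: "Re (a j) > -1" if "j \<ge> 1" for j
  proof -
    have "real j * Re s > 0" using s that by (intro mult_pos_pos) auto
    then show ?thesis using that by (simp add: a_def)
  qed
  show ?thesis
    using \<open>j \<ge> 1\<close>
  proof (induction n arbitrary: j)
    case 0
    have "Re (a j) > -1" by (rule a1[OF 0])
    then show ?case using has_bochner_integral_hankel_kernel_0[of "a j" "b j"] by simp
  next
    case (Suc n)
    have "Re (a j) > -1" by (rule a1[OF Suc.prems])
    moreover have "2 * a j + 2 + b j = a (j + 1)" "- a j - 2 = b (j + 1)"
      by (simp_all add: a_def b_def algebra_simps)
    ultimately have "has_bochner_integral (Pi\<^sub>M {..<2 * (n + 1) + 1} (\<lambda>_. lborel)) (hankel_kernel (n + 1) (a j) (b j))
       (fold_factor (a j) * ((\<Prod>i = j + 1..<j + 1 + n. fold_factor (a i)) * Gamma (a (j + 1 + n) + 1)))"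
      using Suc.IH[of "j + 1"] by (intro has_bochner_integral_hankel_kernel_step) simp_all
    moreover have "(\<Prod>i = j..<j + Suc n. fold_factor (a i)) = fold_factor (a j) * (\<Prod>i = j + 1..<j + 1 + n. fold_factor (a i))"
      by (subst prod.atLeast_Suc_lessThan) simp_all
    ultimately show ?case by (simp add: mult.assoc)
  qed
qed

section \<open>The Gamma product and its continuation\<close>

lemma meromorphic_on_Gamma_comp:
  fixes f :: "complex \<Rightarrow> complex"
  assumes "f analytic_on A"
  shows "(\<lambda>s. Gamma (f s)) meromorphic_on A"
proof -
  have "(\<lambda>s. inverse (rGamma (f s))) meromorphic_on A"
    using assms by (intro meromorphic_on_inverse analytic_on_imp_meromorphic_on analytic_on_rGamma)
  then show ?thesis by (simp add: rGamma_inverse_Gamma)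
qed

text \<open>
  The identity theorem for meromorphic functions. After removal of the singularities the difference
  takes the value \<open>0\<close> near a point of \<open>D\<close>, hence everywhere; removing singularities changes it only on
  a sparse set.
\<close>

lemma meromorphic_eq_on_open_imp_eventually_eq:
  assumes F: "F meromorphic_on UNIV" and G: "G meromorphic_on UNIV"
    and D: "open D" "D \<noteq> {}" and eq: "\<And>s. s \<in> D \<Longrightarrow> F s = G s"
  shows "\<forall>\<^sub>\<approx>s\<in>UNIV. F s = G s"
proof -
  let ?h = "\<lambda>s. F s - G s"
  obtain s where s: "s \<in> D" using D by auto
  have h: "?h meromorphic_on UNIV" using F G by (rule meromorphic_on_diff)
  have ev: "\<forall>\<^sub>\<approx>s\<in>UNIV. remove_sings ?h s = ?h s"
    by (rule eventually_remove_sings_eq[OF h])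
  have "eventually (\<lambda>w. remove_sings ?h w = ?h w) (at s)"
    using ev by (rule eventually_cosparse_imp_eventually_at) simp
  moreover have "eventually (\<lambda>w. w \<in> D) (at s)"
    using D(1) s by (rule eventually_at_in_open')
  ultimately have "eventually (\<lambda>w. remove_sings ?h w = 0) (at s)"
    by eventually_elim (simp add: eq)
  then have "frequently (\<lambda>w. remove_sings ?h w = 0) (at s)"
    by (rule eventually_frequently[rotated]) simp
  then have "remove_sings ?h w = 0" for w
    by (rule frequently_eq_meromorphic_imp_constant[where A = UNIV])
       (use remove_sings_nicely_meromorphic[OF h] in auto)
  with ev show ?thesis by simp
qed

lemma hankel_integrand_eq_kernel:
  assumes "x \<in> space (coord_lebesgue (2 * n + 1))"
  shows "indicator (hankel_cone (n + 1)) x *\<^sub>R hankel_integrand (n + 1) s x = hankel_kernel n s 0 x"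
proof (cases "hankel_pos (n + 1) x")
  case True
  have "space (coord_lebesgue (2 * n + 1)) = {..<2 * (n + 1) - 1} \<rightarrow>\<^sub>E UNIV"
    by (simp add: coord_lebesgue_def space_PiM)
  then have "x \<in> hankel_cone (n + 1)"
    using assms True unfolding hankel_cone_def positive_definite_hankel_iff_pos by simp
  moreover have "hankel_det (n + 1) x > 0" using True by simp
  ultimately show ?thesis
    using True by (simp add: hankel_integrand_def hankel_kernel_def cpow_eq_powr) (simp add: cpow_def)
next
  case False
  then have "x \<notin> hankel_cone (n + 1)" by (simp add: hankel_cone_def positive_definite_hankel_iff_pos)
  then show ?thesis using False by (simp add: hankel_kernel_def del: hankel_pos.simps)
qed

text \<open>
  The value produced by the recursion is a single Gamma factor times elementary factors
  \<open>\<pi> / ((j \<tau> - 1) 2\<^sup>2\<^sup>j\<^sup>\<tau>\<^sup>-\<^sup>2)\<close>. Passing from \<open>n\<close> to \<open>n + 1\<close> replaces \<open>\<Gamma>(z - 1)\<close>, where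
  \<open>z = (n + 1) \<tau>\<close>, by \<open>\<Gamma>(z + \<tau> - 1)\<close> and adds the elementary factor with denominator \<open>z - 1\<close>; since
  \<open>(z - 1) \<Gamma>(z - 1) = \<Gamma>(z)\<close>, this multiplies the value by the next Gamma quotient on the right.
\<close>

lemma prod_fold_factor_Gamma:
  fixes s :: complex
  assumes "Re s > 0"
  defines "\<tau> \<equiv> s + 2"
  shows "(\<Prod>i = 1..<1 + n. fold_factor (of_nat i * s + 2 * (of_nat i - 1)))
           * Gamma (of_nat (1 + n) * s + 2 * (of_nat (1 + n) - 1) + 1) =
         2 powr (of_nat n - of_nat n * of_nat (n + 1) * \<tau>) * (2 * of_real pi) ^ n * Gamma (\<tau> - 1) *
           (\<Prod>j = 2..n + 1. Gamma (of_nat j * \<tau> - 1) / Gamma (of_nat (j - 1) * \<tau>))"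
proof (induction n)
  case 0
  then show ?case by (simp add: \<tau>_def algebra_simps)
next
  case (Suc n)
  let ?z = "of_nat (n + 1) * \<tau> - 1"
  let ?f = "\<lambda>j. Gamma (of_nat j * \<tau> - 1) / Gamma (of_nat (j - 1) * \<tau>)"
  have "Re ?z > 0"
  proof -
    have eq: "Re ?z = (real n + 1) * (Re s + 2) - 1" by (simp add: \<tau>_def)
    have "1 < 1 * (Re s + 2)" using assms(1) by simp
    also have "\<dots> \<le> (real n + 1) * (Re s + 2)"
      using assms(1) by (intro mult_right_mono) auto
    finally show ?thesis unfolding eq by (simp only: diff_gt_0_iff_gt)
  qed
  moreover have "w \<notin> \<int>\<^sub>\<le>\<^sub>0" "w \<noteq> 0" if "Re w > 0" for w :: complex
    using that by (auto elim!: nonpos_Ints_cases)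
  ultimately have z: "?z \<notin> \<int>\<^sub>\<le>\<^sub>0" "?z \<noteq> 0" by blast+
  have arg: "of_nat (1 + n) * s + 2 * (of_nat (1 + n) - 1) = ?z - 1"
       "of_nat (1 + Suc n) * s + 2 * (of_nat (1 + Suc n) - 1) + 1 = of_nat (n + 2) * \<tau> - 1"
    by (simp_all add: \<tau>_def algebra_simps)
  have G: "Gamma (of_nat (n + 1) * \<tau>) = ?z * Gamma ?z" "Gamma ?z \<noteq> 0"
    using Gamma_plus1[OF z(1)] z(1) by (simp_all add: Gamma_eq_zero_iff)
  have idx: "n + 2 - 1 = n + 1" by simp
  have ff: "fold_factor (?z - 1) = of_real pi / (?z * 2 powr (2 * ?z))"
    by (simp add: fold_factor_def)
  have pow: "2 powr (of_nat (Suc n) - of_nat (Suc n) * of_nat (Suc n + 1) * \<tau>) =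
      2 powr (of_nat n - of_nat n * of_nat (n + 1) * \<tau>) / (2 * 2 powr (2 * ?z))"
  proof -
    have double: "2 powr (1 + w) = 2 * 2 powr w" for w :: complex
      by (simp add: powr_add)
    have "of_nat (Suc n) - of_nat (Suc n) * of_nat (Suc n + 1) * \<tau> =
        (of_nat n - of_nat n * of_nat (n + 1) * \<tau>) - (1 + 2 * ?z)"
      by (simp add: algebra_simps)
    then show ?thesis
      by (simp only: powr_diff double)
  qed
  have "(\<Prod>i = 1..<1 + Suc n. fold_factor (of_nat i * s + 2 * (of_nat i - 1)))
       * Gamma (of_nat (1 + Suc n) * s + 2 * (of_nat (1 + Suc n) - 1) + 1)
     = (\<Prod>i = 1..<1 + n. fold_factor (of_nat i * s + 2 * (of_nat i - 1))) * fold_factor (?z - 1)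
         * Gamma (of_nat (n + 2) * \<tau> - 1)"
    unfolding arg(2) by (simp only: arg(1) prod.atLeastLessThan_Suc add_Suc_right le_add1 flip: arg(1))
  also have "\<dots> = ((\<Prod>i = 1..<1 + n. fold_factor (of_nat i * s + 2 * (of_nat i - 1))) * Gamma ?z) *
      (fold_factor (?z - 1) * Gamma (of_nat (n + 2) * \<tau> - 1) / Gamma ?z)"
    using G(2) by simp
  also have "(\<Prod>i = 1..<1 + n. fold_factor (of_nat i * s + 2 * (of_nat i - 1))) * Gamma ?z =
      2 powr (of_nat n - of_nat n * of_nat (n + 1) * \<tau>) * (2 * of_real pi) ^ n * Gamma (\<tau> - 1) * (\<Prod>j = 2..n + 1. ?f j)"
    using Suc.IH unfolding arg(1) by simp
  also have "fold_factor (?z - 1) * Gamma (of_nat (n + 2) * \<tau> - 1) / Gamma ?z =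
      of_real pi / 2 powr (2 * ?z) * ?f (n + 2)"
    unfolding ff idx G(1)
    by (simp only: times_divide_eq_left times_divide_eq_right divide_divide_eq_left mult_ac)
  also have "2 powr (of_nat n - of_nat n * of_nat (n + 1) * \<tau>) * (2 * of_real pi) ^ n * Gamma (\<tau> - 1)
        * (\<Prod>j = 2..n + 1. ?f j) * (of_real pi / 2 powr (2 * ?z) * ?f (n + 2))
      = 2 powr (of_nat n - of_nat n * of_nat (n + 1) * \<tau>) / (2 * 2 powr (2 * ?z)) * (2 * of_real pi) ^ Suc n * Gamma (\<tau> - 1)
        * ((\<Prod>j = 2..n + 1. ?f j) * ?f (n + 2))"
    by (simp add: field_simps)
  also have "(\<Prod>j = 2..n + 1. ?f j) * ?f (n + 2) = (\<Prod>j = 2..Suc n + 1. ?f j)"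
    by (simp add: prod.nat_ivl_Suc')
  finally show ?case unfolding pow .
qed

theorem theorem4p1:
  fixes m r :: nat and F :: "complex \<Rightarrow> complex"
  assumes "m \<ge> 1" and "r = m - 1"
    and "\<And>s \<tau>. \<tau> = s + 2 \<Longrightarrow>
           F s = 2 powr (of_nat r - of_nat r * of_nat m * \<tau>) * (2 * of_real pi) ^ r
                 * Gamma (\<tau> - 1)
                 * (\<Prod>j = 2..m. Gamma (of_nat j * \<tau> - 1) / Gamma (of_nat (j - 1) * \<tau>))"
  shows "(\<forall>s. Re s > 0 \<longrightarrow>
            set_integrable (coord_lebesgue (2 * m - 1)) (hankel_cone m) (hankel_integrand m s))
       \<and> is_meromorphic_continuation (hankel_zeta m) {s. Re s > 0} F
       \<and> (\<forall>G. is_meromorphic_continuation (hankel_zeta m) {s. Re s > 0} G \<longrightarrow>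
              (\<forall>\<^sub>\<approx>s\<in>UNIV. G s = F s))"
proof -
  have m: "m = r + 1" using assms(1,2) by simp
  have int: "has_bochner_integral (coord_lebesgue (2 * m - 1))
      (\<lambda>x. indicator (hankel_cone m) x *\<^sub>R hankel_integrand m s x) (F s)" if s: "Re s > 0" for s
  proof -
    have "has_bochner_integral (Pi\<^sub>M {..<2 * r + 1} (\<lambda>_. lborel)) (hankel_kernel r s 0) (F s)"
      using has_bochner_integral_hankel_kernel[OF s order.refl, of r]
      unfolding prod_fold_factor_Gamma[OF s] assms(3)[OF refl] m by simp
    moreover have "2 * m - 1 = 2 * r + 1" using m by simp
    ultimately show ?thesis
      unfolding m using hankel_integrand_eq_kernel[of _ r s]
      by (subst has_bochner_integral_cong[OF refl _ refl]) (auto simp: coord_lebesgue_def)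
  qed
  have F: "F meromorphic_on UNIV"
  proof -
    have eq: "F = (\<lambda>s. exp ((of_nat r - of_nat r * of_nat m * (s + 2)) * of_real (ln 2)) * (2 * of_real pi) ^ r
                 * Gamma (s + 2 - 1)
                 * (\<Prod>j = 2..m. Gamma (of_nat j * (s + 2) - 1) / Gamma (of_nat (j - 1) * (s + 2))))"
      using assms(3)[OF refl] by (simp add: fun_eq_iff cpow_eq_powr[of 2, simplified, symmetric] cpow_def)
    show ?thesis
      unfolding eq
      by (intro meromorphic_on_mult meromorphic_on_prod meromorphic_on_divide meromorphic_on_Gamma_comp
            analytic_on_imp_meromorphic_on) (auto intro!: analytic_intros)
  qed
  have zeta: "F s = hankel_zeta m s" if "Re s > 0" for s
    using int[OF that] by (simp add: hankel_zeta_def set_lebesgue_integral_def has_bochner_integral_iff)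
  have "set_integrable (coord_lebesgue (2 * m - 1)) (hankel_cone m) (hankel_integrand m s)" if "Re s > 0" for s
    using int[OF that] by (simp add: set_integrable_def has_bochner_integral_iff)
  moreover have "\<forall>\<^sub>\<approx>s\<in>UNIV. G s = F s"
    if "is_meromorphic_continuation (hankel_zeta m) {s. Re s > 0} G" for G
  proof (rule meromorphic_eq_on_open_imp_eventually_eq)
    show "open {s. Re s > 0}" by (rule open_halfspace_Re_gt)
    have "Re 1 > 0" by simp
    then show "{s. Re s > 0} \<noteq> {}" by blast
  qed (use that F zeta in \<open>auto simp: is_meromorphic_continuation_def\<close>)
  ultimately show ?thesis
    using F zeta by (auto simp: is_meromorphic_continuation_def)
qed

end
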